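(* Let $\psi^0=21$, $\psi^1=3412$, $\psi^2=351624$, and for $r\ge 3$ let $$\psi^r=3\;5\;1\;7\;2\;9\;4\;11\;\ldots\;(2r+1)\;(2r-4)\;(2r+2)\;(2r-2)\;(2r)$$ (that is, $\psi^r\in\mathcal{I}_{2r+2}$ is the involution exchanging $1\leftrightarrow 3$, $2j\leftrightarrow 2j+3$ for $1\le j\le r-1$, and $2r\leftrightarrow 2r+2$). Then for every $r\geq 0$ the only kernel involution of capacity $r$ and size $2r+2$ is $\psi^r$. Its contribution to $I_r(x)$, i.e. the generating function $\sum_{n\ge0}|\{\pi\in\mathcal{I}_n\cap\mathcal{I}(\psi^r): \pi \text{ has exactly } r\text{ occurrences of }3412\}|\,x^n$, equals $$\frac{x^{2r+2}}{(1-x)^r}\,I_0(x)^{r+2}.$$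
   Context: Permutations are in one-line notation. $\mathcal{I}_n$ is the set of involutions ($\pi=\pi^{-1}$) of $\{1,\dots,n\}$, $n\ge 0$. An occurrence of $3412$ in $\pi$ is a subsequence of four entries of $\pi$ order-isomorphic to $3412$. $I_r(x)=\sum_{n\ge 0}|\{\pi\in\mathcal{I}_n:\pi\text{ has exactly } r \text{ occurrences of }3412\}|\,x^n$. For $\pi\in\mathcal{I}_n$, $G_\pi$ is the bipartite graph whose vertices are the entries of $\pi$ (one part) and the occurrences of $3412$ in $\pi$ (other part), an entry being joined to an occurrence iff it belongs to it. For $n\ge1$ the kernel $\ker\pi$ consists of the entries of $\pi$ lying in the connected component of $G_\pi$ containing the entry $1$, together with the entry $\pi(1)$ (so if the entry $1$ lies in no occurrence of $3412$, the kernel is $\{1,\pi(1)\}$, of shape $1$ or $21$). The kernel shape of $\pi$ is the involution $\rho$ order-isomorphic to the subsequence $\ker\pi$. A kernel involution is an involution that is the kernel shape of some involution; its size is its length and its capacity is the number of occurrences of $3412$ in it. $\mathcal{I}(\rho)$ is the set of all involutions (of all sizes) with kernel shape $\rho$. *)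

theory Defs
  imports
    "HOL-Combinatorics.Multiset_Permutations"
    "HOL-Library.Sublist"
    "HOL-Computational_Algebra.Formal_Power_Series"
begin

text \<open>A permutation of $\{1,\dots,n\}$ is represented by its one-line notation, a list over
  \<^term>\<open>{1..n}\<close>. Positions are counted from 1, list indices from 0.\<close>

definition entry :: "nat list \<Rightarrow> nat \<Rightarrow> nat" where
  "entry w i = w ! (i - 1)"

definition involutions :: "nat \<Rightarrow> nat list set" where
  "involutions n =
     {w \<in> permutations_of_set {1..n}. \<forall>i\<in>{1..n}. entry w (entry w i) = i}"

definition order_isomorphic :: "nat list \<Rightarrow> nat list \<Rightarrow> bool" where
  "order_isomorphic xs ys \<longleftrightarrow> length xs = length ys \<and>
     (\<forall>i<length xs. \<forall>j<length xs. xs ! i < xs ! j \<longleftrightarrow> ys ! i < ys ! j)"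

text \<open>The entries of a permutation are distinct, so a subsequence is determined by its list of
  values and occurrences may be counted as lists.\<close>

definition occurrences :: "nat list \<Rightarrow> nat list set" where
  "occurrences w = {s. subseq s w \<and> order_isomorphic s [3, 4, 1, 2]}"

definition capacity :: "nat list \<Rightarrow> nat" where
  "capacity w = card (occurrences w)"

text \<open>The bipartite graph on entries (\<^const>\<open>Inl\<close>) and occurrences of 3412
  (\<^const>\<open>Inr\<close>). The edges are oriented from entries to occurrences here;
  \<open>component\<close> takes the symmetric closure.\<close>

definition graph_verts :: "nat list \<Rightarrow> (nat + nat list) set" where
  "graph_verts w = set w <+> occurrences w"

definition graph_edges :: "nat list \<Rightarrow> ((nat + nat list) \<times> (nat + nat list)) set" where
  "graph_edges w = {(Inl a, Inr s) | a s. a \<in> set w \<and> s \<in> occurrences w \<and> a \<in> set s}"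

definition component :: "nat list \<Rightarrow> nat + nat list \<Rightarrow> (nat + nat list) set" where
  "component w u =
     {v \<in> graph_verts w. (u, v) \<in> (graph_edges w \<union> (graph_edges w)\<inverse>)\<^sup>*}"

text \<open>Only meaningful for nonempty permutations.\<close>

definition kernel :: "nat list \<Rightarrow> nat set" where
  "kernel w = {a \<in> set w. Inl a \<in> component w (Inl 1)} \<union> {entry w 1}"

definition kernel_shape :: "nat list \<Rightarrow> nat list \<Rightarrow> bool" where
  "kernel_shape w \<rho> \<longleftrightarrow>
     (\<exists>m. \<rho> \<in> involutions m) \<and> order_isomorphic \<rho> (filter (\<lambda>a. a \<in> kernel w) w)"

definition involutions_of_shape :: "nat list \<Rightarrow> nat list set" where
  "involutions_of_shape \<rho> = {w. (\<exists>n\<ge>1. w \<in> involutions n) \<and> kernel_shape w \<rho>}"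

definition kernel_involution :: "nat list \<Rightarrow> bool" where
  "kernel_involution \<rho> \<longleftrightarrow> (\<exists>n\<ge>1. \<exists>w\<in>involutions n. kernel_shape w \<rho>)"

definition I_gf :: "nat \<Rightarrow> rat fps" where
  "I_gf r = Abs_fps (\<lambda>n. of_nat (card {w \<in> involutions n. capacity w = r}))"

definition contribution :: "nat list \<Rightarrow> nat \<Rightarrow> rat fps" where
  "contribution \<rho> r = Abs_fps (\<lambda>n. of_nat
     (card {w \<in> involutions n \<inter> involutions_of_shape \<rho>. capacity w = r}))"

text \<open>For \<open>r \<ge> 2\<close>: $1 \leftrightarrow 3$, $2r \leftrightarrow 2r+2$, and
  $2j \leftrightarrow 2j+3$ for $1 \le j \le r-1$; see \<open>psi_exchanges\<close>.\<close>

definition psi_entry :: "nat \<Rightarrow> nat \<Rightarrow> nat" where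
  "psi_entry r i =
     (if i = 1 then 3 else if i = 3 then 1
      else if i = 2 * r then 2 * r + 2 else if i = 2 * r + 2 then 2 * r
      else if even i then i + 3 else i - 3)"

definition psi :: "nat \<Rightarrow> nat list" where
  "psi r =
     (if r = 0 then [2, 1] else if r = 1 then [3, 4, 1, 2]
      else map (psi_entry r) [1..<2 * r + 3])"

lemma psi_small:
  "psi 2 = [3, 5, 1, 6, 2, 4]"
  "psi 3 = [3, 5, 1, 7, 2, 8, 4, 6]"
  "psi 4 = [3, 5, 1, 7, 2, 9, 4, 10, 6, 8]"
  by (simp_all add: psi_def psi_entry_def upt_rec)

lemma length_psi: "length (psi r) = 2 * r + 2"
  by (simp add: psi_def)

lemma entry_psi:
  assumes "r \<ge> 2" "1 \<le> i" "i \<le> 2 * r + 2"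
  shows "entry (psi r) i = psi_entry r i"
proof -
  have "[1..<2 * r + 3] ! (i - 1) = i"
    using assms by (subst nth_upt) auto
  moreover have "i - 1 < length [1..<2 * r + 3]"
    using assms by simp
  ultimately show ?thesis
    using assms(1) by (simp add: entry_def psi_def del: upt.simps)
qed

lemma psi_exchanges:
  assumes "r \<ge> 2"
  shows "entry (psi r) 1 = 3" "entry (psi r) 3 = 1"
    "\<And>j. 1 \<le> j \<Longrightarrow> j \<le> r - 1 \<Longrightarrow> entry (psi r) (2 * j) = 2 * j + 3"
    "\<And>j. 1 \<le> j \<Longrightarrow> j \<le> r - 1 \<Longrightarrow> entry (psi r) (2 * j + 3) = 2 * j"
    "entry (psi r) (2 * r) = 2 * r + 2" "entry (psi r) (2 * r + 2) = 2 * r"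
  using assms by (auto simp: entry_psi psi_entry_def) presburger+

end

theory Submission
  imports Defs
begin

text \<open>
  Write an involution as a set of arcs \<open>(i, f i)\<close> and fixed points. In every occurrence of 3412 the
  two lower or the two upper entries belong to crossing arcs, and crossing arcs form an occurrence of
  their own; all other occurrences come in pairs exchanged by reflection in the diagonal. Hence, when
  a kernel is built up from \<open>{1, f 1}\<close> by adding one occurrence at a time together with its
  reflection, every new occurrence accounts for at most two new entries, so a kernel with \<open>r\<close>
  occurrences has at most \<open>2 r + 2\<close> entries. Equality forces the crossing graph of the arcs to be a
  path in which arcs at distance two are disjoint intervals, and these arcs, read from left to right,
  form \<open>\<psi>\<^sup>r\<close>.

  If all occurrences of an involution lie in a kernel of shape \<open>\<psi>\<^sup>r\<close>, then no other arc crosses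
  a kernel arc, and since different gaps between kernel entries are covered by different sets of
  kernel arcs, the involution preserves each of the \<open>2 r + 2\<close> gaps. An increasing pair in a gap
  covered by two arcs would form an occurrence with these arcs, so the \<open>r\<close> gaps of this kind are
  filled by decreasing words; the other \<open>r + 2\<close> gaps are filled by arbitrary 3412-avoiding
  involutions.
\<close>

section \<open>Occurrences of 3412 in an involution\<close>

text \<open>The constant 2 r + 2 comes from the initial set \<open>{1, f 1}\<close>: it has at most
  two entries and may contain no occurrence, so the claim is that
  \<open>card S - 2 * card (inside S)\<close> never exceeds 2 while S grows. The obstacle is that an
  occurrence and its reflection can bring up to six new entries, so these two alone do not pay for
  the step. Hence there are two kinds of steps. As long as an outside arc crosses an arc of S, that
  arc alone is added: two entries against at least one occurrence. A whole occurrence is added only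
  when nothing crosses the boundary of S; then its two crossing arcs lie on the same side, and
  further occurrences appear because an entry can be moved to the other end of its arc. A step of
  the second kind lowers the excess unless S contains a fixed point, and tight sets contain none. So
  tight sets arise only from steps of the first kind with exactly one new occurrence each, which
  leaves the path as the only possibility. In the enumeration, \<open>psi r\<close> itself is the
  case of empty gaps, so its capacity follows from the analysis of the words built around
  it.\<close>

locale involution_word =
  fixes w :: "nat list" and n :: nat
  assumes w: "w \<in> involutions n"
begin

abbreviation f :: "nat \<Rightarrow> nat" where "f \<equiv> entry w"

lemma set_w: "set w = {1..n}" and distinct_w: "distinct w"
  using w by (auto simp: involutions_def permutations_of_set_def)

lemma length_w: "length w = n"
  using set_w distinct_w distinct_card by force

lemma f_f: "x \<in> {1..n} \<Longrightarrow> f (f x) = x"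
  using w by (auto simp: involutions_def)

lemma f_in: "x \<in> {1..n} \<Longrightarrow> f x \<in> {1..n}"
  unfolding entry_def set_w[symmetric] by (rule nth_mem) (auto simp: length_w set_w)

lemma f_eq_iff: "x \<in> {1..n} \<Longrightarrow> y \<in> {1..n} \<Longrightarrow> f x = f y \<longleftrightarrow> x = y"
  by (metis f_f)

lemma w_eq: "w = map f [1..<n + 1]"
  by (rule nth_equalityI) (auto simp: length_w entry_def nth_append simp del: upt.simps)

text \<open>The arguments come in the order of the word. As \<open>w\<close> is an involution,
  \<open>f x\<close> is also the position of the entry \<open>x\<close>; the second chain of
  inequalities says that \<open>c\<close>, \<open>d\<close>, \<open>a\<close>, \<open>b\<close>
  appear from left to right.\<close>

definition pat :: "nat \<Rightarrow> nat \<Rightarrow> nat \<Rightarrow> nat \<Rightarrow> bool" where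
  "pat c d a b \<longleftrightarrow> a \<in> {1..n} \<and> b \<in> {1..n} \<and> c \<in> {1..n} \<and> d \<in> {1..n} \<and>
     a < b \<and> b < c \<and> c < d \<and> f c < f d \<and> f d < f a \<and> f a < f b"

lemma order_isomorphic_3412:
  "order_isomorphic [c, d, a, b] [3, 4, 1, 2] \<longleftrightarrow> a < b \<and> b < c \<and> c < d"
  by (auto simp: order_isomorphic_def All_less_Suc)

text \<open>Applying \<open>f\<close> replaces entries by their positions and turns \<open>w\<close>
  into \<open>[1..<n + 1]\<close>, so being a subsequence becomes being increasing.\<close>

lemma subseq_w_iff:
  assumes "a \<in> {1..n}" "b \<in> {1..n}" "c \<in> {1..n}" "d \<in> {1..n}"
  shows "subseq [c, d, a, b] w \<longleftrightarrow> f c < f d \<and> f d < f a \<and> f a < f b"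
proof
  assume "subseq [c, d, a, b] w"
  then have "subseq (map f [c, d, a, b]) (map f w)"
    by (rule subseq_map)
  moreover have "map f w = [1..<n + 1]"
    by (subst w_eq) (auto simp: f_f simp del: upt.simps intro!: map_idI)
  ultimately have "subseq (map f [c, d, a, b]) [1..<n + 1]" by simp
  then have "sorted_wrt (<) (map f [c, d, a, b])"
    by (metis distinct_nthsI distinct_upt sorted_nths sorted_upt strict_sorted_iff subseq_conv_nths)
  then show "f c < f d \<and> f d < f a \<and> f a < f b" by simp
next
  assume *: "f c < f d \<and> f d < f a \<and> f a < f b"
  have "subseq [f c, f d, f a, f b] [1..<n + 1]"
    using * f_in assms
    by (intro sorted_subset_imp_subseq) (auto simp del: upt.simps simp: less_Suc_eq_le)
  then have "subseq (map f [f c, f d, f a, f b]) (map f [1..<n + 1])"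
    by (rule subseq_map)
  then show "subseq [c, d, a, b] w"
    using assms by (simp only: w_eq[symmetric] list.map f_f)
qed

lemma in_occurrences_iff: "[c, d, a, b] \<in> occurrences w \<longleftrightarrow> pat c d a b"
proof -
  have "set s \<subseteq> {1..n}" if "subseq s w" for s
    using list_emb_set[OF that] unfolding set_w[symmetric] by blast
  from this[of "[c, d, a, b]"]
  have "subseq [c, d, a, b] w \<Longrightarrow> {a, b, c, d} \<subseteq> {1..n}" by simp
  then show ?thesis
    unfolding occurrences_def mem_Collect_eq order_isomorphic_3412 pat_def
    using subseq_w_iff[of a b c d] by blast
qed

lemma occurrence_cases:
  assumes "s \<in> occurrences w"
  obtains c d a b where "s = [c, d, a, b]" "pat c d a b"
proof -
  have "length s = 4"
    using assms by (auto simp: occurrences_def order_isomorphic_def)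
  then obtain c d a b where "s = [c, d, a, b]"
    by (auto simp: eval_nat_numeral length_Suc_conv)
  then show ?thesis using that assms in_occurrences_iff by simp
qed

lemma occurrences_eq: "occurrences w = {[c, d, a, b] | c d a b. pat c d a b}"
  by (auto simp: in_occurrences_iff elim: occurrence_cases)

lemma finite_occurrences: "finite (occurrences w)"
proof (rule finite_subset)
  show "occurrences w \<subseteq> {s. set s \<subseteq> {1..n} \<and> length s = 4}"
    by (auto simp: occurrences_eq pat_def)
qed (simp add: finite_lists_length_eq)

text \<open>The pattern 3412 is itself an involution, so reflecting an occurrence in the diagonal
  gives an occurrence.\<close>

lemma pat_mirror: "pat c d a b \<Longrightarrow> pat (f a) (f b) (f c) (f d)"
  using f_in by (auto simp: pat_def f_f)

text \<open>The ends of two crossing arcs form an occurrence that is its own reflection.\<close>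

lemma pat_crossing:
  assumes "i \<in> {1..n}" "k \<in> {1..n}" "i < k" "k < f i" "f i < f k"
  shows "pat (f i) (f k) i k"
  using assms f_in by (auto simp: pat_def f_f)

text \<open>If both failed, then \<open>c \<le> f d < f a \<le> b < c\<close>. In the first case the
  arcs of \<open>a\<close> and \<open>b\<close> cross, in the second those of \<open>c\<close> and
  \<open>d\<close>; reflection exchanges the two cases.\<close>

lemma pat_crossing_cases:
  assumes "pat c d a b"
  obtains "b < f a" | "f d < c"
  using assms by (meson leI less_le_trans less_trans order.asym pat_def)

end

section \<open>Kernels\<close>

lemma strict_mono_on_map_upt:
  fixes K :: "nat \<Rightarrow> nat"
  assumes "strict_mono_on {1..m} K"
  shows "map K [1..<m + 1] = sorted_list_of_set (K ` {1..m})"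
proof (rule sorted_distinct_set_unique)
  show "sorted (map K [1..<m + 1])" "distinct (map K [1..<m + 1])"
    using assms strict_mono_on_imp_inj_on[OF assms]
    by (auto simp: distinct_map sorted_map sorted_wrt_iff_nth_less strict_mono_on_def less_imp_le
        atLeastLessThanSuc_atLeastAtMost simp del: upt.simps)
qed (auto simp: atLeastLessThanSuc_atLeastAtMost simp del: upt.simps)

lemma strict_mono_on_image_unique:
  fixes K K' :: "nat \<Rightarrow> nat"
  assumes "strict_mono_on {1..m} K" "strict_mono_on {1..m'} K'" "K ` {1..m} = K' ` {1..m'}"
  shows "m = m'" and "\<And>i. i \<in> {1..m} \<Longrightarrow> K i = K' i"
proof -
  have eq: "map K [1..<m + 1] = map K' [1..<m' + 1]"
    using strict_mono_on_map_upt[OF assms(1)] strict_mono_on_map_upt[OF assms(2)] assms(3) by simp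
  from arg_cong[OF eq, of length] show m: "m = m'"
    by (simp del: upt.simps)
  show "K i = K' i" if "i \<in> {1..m}" for i
    using eq that unfolding m[symmetric] map_eq_conv by (auto simp del: upt.simps)
qed

lemma order_isomorphic_map:
  assumes "strict_mono_on (set xs) h"
  shows "order_isomorphic xs (map h xs)"
  using strict_mono_on_less[OF assms] by (auto simp: order_isomorphic_def)

lemma order_isomorphic_imp_map:
  assumes "order_isomorphic xs ys" "distinct xs"
  obtains h where "strict_mono_on (set xs) h" "ys = map h xs"
proof
  let ?h = "\<lambda>v. the (map_of (zip xs ys) v)"
  have len: "length xs = length ys"
    using assms by (simp add: order_isomorphic_def)
  have nth: "?h (xs ! i) = ys ! i" if "i < length xs" for i
    using map_of_zip_nth[OF len assms(2)] that len by simp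
  show "ys = map ?h xs"
    by (rule nth_equalityI) (use len nth in auto)
  show "strict_mono_on (set xs) ?h"
    using assms(1) by (auto simp: strict_mono_on_def in_set_conv_nth nth order_isomorphic_def)
qed

lemma order_isomorphic_map_left:
  assumes "strict_mono_on (set xs) h"
  shows "order_isomorphic (map h xs) p \<longleftrightarrow> order_isomorphic xs p"
  using strict_mono_on_less[OF assms] by (auto simp: order_isomorphic_def)

lemma capacity_map:
  assumes "strict_mono_on (set xs) h"
  shows "capacity (map h xs) = capacity xs"
proof -
  have sub: "set s \<subseteq> set xs" if "subseq s xs" for s
    using that list_emb_set[of "(=)" s xs] by blast
  have "bij_betw (map h) (occurrences xs) (occurrences (map h xs))"
    unfolding bij_betw_def
  proof
    show "inj_on (map h) (occurrences xs)"
    proof (rule inj_onI)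
      fix s t assume "s \<in> occurrences xs" "t \<in> occurrences xs" and eq: "map h s = map h t"
      then have "inj_on h (set s \<union> set t)"
        using sub strict_mono_on_imp_inj_on[OF assms]
        by (auto simp: occurrences_def intro: inj_on_subset)
      then show "s = t" using eq inj_on_map_eq_map by blast
    qed
    have iso: "order_isomorphic (map h s) p \<longleftrightarrow> order_isomorphic s p" if "subseq s xs" for s p
      using order_isomorphic_map_left[of s h p] monotone_on_subset[OF assms sub[OF that]] by blast
    show "map h ` occurrences xs = occurrences (map h xs)"
    proof (intro equalityI subsetI)
      fix s assume "s \<in> occurrences (map h xs)"
      then have "subseq s (map h xs)" and o: "order_isomorphic s [3, 4, 1, 2]"
        by (auto simp: occurrences_def)
      then obtain N where s: "s = map h (nths xs N)"
        by (auto simp: subseq_conv_nths nths_map)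
      have "subseq (nths xs N) xs"
        by (auto simp: subseq_conv_nths)
      then show "s \<in> map h ` occurrences xs"
        using o iso s by (auto simp: occurrences_def)
    qed (auto simp: occurrences_def iso subseq_map)
  qed
  then show ?thesis
    unfolding capacity_def by (simp add: bij_betw_same_card)
qed

lemma occurrences_filter: "occurrences (filter P xs) = {s \<in> occurrences xs. \<forall>x\<in>set s. P x}"
proof -
  have "subseq s (filter P xs) \<longleftrightarrow> subseq s xs \<and> (\<forall>x\<in>set s. P x)" for s
  proof
    assume *: "subseq s (filter P xs)"
    then have "subseq s xs"
      using subseq_filter_left subseq_order.order_trans by blast
    moreover have "set s \<subseteq> set (filter P xs)"
      using list_emb_set[OF *] by blast
    ultimately show "subseq s xs \<and> (\<forall>x\<in>set s. P x)" by auto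
  next
    assume *: "subseq s xs \<and> (\<forall>x\<in>set s. P x)"
    then have "filter P s = s" by (simp add: filter_id_conv)
    moreover have "subseq (filter P s) (filter P xs)"
      using * by (intro subseq_filter) simp
    ultimately show "subseq s (filter P xs)" by (simp only:)
  qed
  then show ?thesis by (auto simp: occurrences_def)
qed

context involution_word
begin

definition inside :: "nat set \<Rightarrow> nat list set" where
  "inside S = {s \<in> occurrences w. set s \<subseteq> S}"

lemma finite_inside: "finite (inside S)"
  using finite_occurrences by (simp add: inside_def)

text \<open>For a set closed under \<open>f\<close>, the entries in \<open>S\<close> stand exactly
  at the positions in \<open>S\<close>.\<close>

lemma filter_w:
  assumes "S \<subseteq> {1..n}" "\<And>x. x \<in> S \<Longrightarrow> f x \<in> S"
  shows "filter (\<lambda>x. x \<in> S) w = map f (filter (\<lambda>x. x \<in> S) [1..<n + 1])"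
proof -
  have "filter (\<lambda>x. x \<in> S) w = map f (filter (\<lambda>x. f x \<in> S) [1..<n + 1])"
    by (subst w_eq) (simp add: filter_map comp_def del: upt.simps)
  also have "filter (\<lambda>x. f x \<in> S) [1..<n + 1] = filter (\<lambda>x. x \<in> S) [1..<n + 1]"
  proof (rule filter_cong)
    fix x assume "x \<in> set [1..<n + 1]"
    then have "f (f x) = x" by (intro f_f) auto
    then show "f x \<in> S \<longleftrightarrow> x \<in> S" using assms(2) by metis
  qed simp
  finally show ?thesis .
qed

end

section \<open>The component of the entry 1, the kernel and its shape\<close>

locale nonempty_involution_word = involution_word +
  assumes n_pos: "1 \<le> n"
begin

definition comp1 :: "nat set" where
  "comp1 = {a \<in> set w. Inl a \<in> component w (Inl 1)}"

lemma kernel_eq: "kernel w = comp1 \<union> {f 1}"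
  by (simp add: kernel_def comp1_def)

lemma comp1_subset: "comp1 \<subseteq> {1..n}"
  by (auto simp: comp1_def set_w)

lemma one_in_comp1: "1 \<in> comp1"
  using n_pos by (auto simp: comp1_def component_def graph_verts_def set_w)

lemma comp1_closed:
  assumes "s \<in> occurrences w" "x \<in> set s" "x \<in> comp1" "y \<in> set s"
  shows "y \<in> comp1"
proof -
  let ?R = "graph_edges w \<union> (graph_edges w)\<inverse>"
  have sub: "set s \<subseteq> set w"
    using assms(1) occurrences_eq by (auto simp: set_w pat_def)
  then have "(Inl x, Inr s) \<in> ?R" "(Inr s, Inl y) \<in> ?R"
    using assms by (auto simp: graph_edges_def)
  moreover have "(Inl 1, Inl x) \<in> ?R\<^sup>*"
    using assms by (auto simp: comp1_def component_def)
  ultimately have "(Inl 1, Inl y) \<in> ?R\<^sup>*"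
    by (meson rtrancl.rtrancl_into_rtrancl)
  then show ?thesis
    using sub assms by (auto simp: comp1_def component_def graph_verts_def)
qed

text \<open>With \<open>comp1_closed\<close>, this replaces paths in the bipartite graph by a
  closure property: \<open>comp1\<close> is the least set that contains 1 and swallows every
  occurrence it meets.\<close>

lemma comp1_least:
  assumes "1 \<in> X" and closed: "\<And>s. s \<in> occurrences w \<Longrightarrow> set s \<inter> X \<noteq> {} \<Longrightarrow> set s \<subseteq> X"
  shows "comp1 \<subseteq> X"
proof
  have closed': "y \<in> X" if "s \<in> occurrences w" "a \<in> set s" "a \<in> X" "y \<in> set s" for s a y
    using closed that by blast
  fix x assume "x \<in> comp1"
  then have "(Inl 1, Inl x) \<in> (graph_edges w \<union> (graph_edges w)\<inverse>)\<^sup>*"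
    by (auto simp: comp1_def component_def)
  then have "case Inl x of Inl a \<Rightarrow> a \<in> X | Inr s \<Rightarrow> s \<in> occurrences w \<and> set s \<subseteq> X"
  proof (induction rule: rtrancl_induct)
    case (step u v)
    then consider a s where "u = Inl a" "v = Inr s" "s \<in> occurrences w" "a \<in> set s"
      | a s where "u = Inr s" "v = Inl a" "a \<in> set s"
      by (auto simp: graph_edges_def)
    then show ?case
    proof cases
      case 1
      then show ?thesis using step.IH closed'[of s a] by auto
    next
      case 2
      then show ?thesis using step.IH by auto
    qed
  qed (use assms(1) in simp)
  then show "x \<in> X" by simp
qed

text \<open>Consequently, joining \<open>f 1\<close> to the component matters only when 1 lies in no
  occurrence. Being the least entry, 1 plays the role of \<open>a\<close>. Either its arc crosses
  that of \<open>b\<close>, and this crossing contains both 1 and \<open>f 1\<close>; or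
  \<open>f d < f 1 < b < c\<close>, so the arcs of \<open>c\<close> and \<open>d\<close> cross, and
  \<open>f 1\<close> is reached from 1 via \<open>c\<close>, then \<open>f c\<close>, then the
  reflected occurrence.\<close>

lemma f_one_in_comp1:
  assumes "s \<in> occurrences w" "1 \<in> set s"
  shows "f 1 \<in> comp1"
proof -
  from assms(1) obtain c d a b where s: "s = [c, d, a, b]" and p: "pat c d a b"
    by (rule occurrence_cases)
  have "a = 1" using p s assms(2) by (auto simp: pat_def)
  note p = p[unfolded this]
  have dom: "1 \<in> {1..n}" "b \<in> {1..n}" "c \<in> {1..n}" "d \<in> {1..n}"
    using p by (auto simp: pat_def)
  have "b \<noteq> f 1"
    using p f_f[of 1] by (auto simp: pat_def)
  then consider "b < f 1" | "f 1 < b" by linarith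
  then show ?thesis
  proof cases
    case 1
    then have "pat (f 1) (f b) 1 b"
      using p dom by (intro pat_crossing) (auto simp: pat_def)
    then show ?thesis
      using comp1_closed[of "[f 1, f b, 1, b]" 1 "f 1"] one_in_comp1 by (simp add: in_occurrences_iff)
  next
    case 2
    have "pat (f (f c)) (f (f d)) (f c) (f d)"
      using p dom 2 f_in by (intro pat_crossing) (auto simp: pat_def f_f)
    then have 3: "[c, d, f c, f d] \<in> occurrences w"
      using dom by (simp add: in_occurrences_iff f_f)
    have "c \<in> comp1"
      using comp1_closed[OF assms(1), of 1 c] one_in_comp1 s \<open>a = 1\<close> by simp
    then have "f c \<in> comp1"
      using comp1_closed[OF 3, of c "f c"] by simp
    moreover have "[f 1, f b, f c, f d] \<in> occurrences w"
      using pat_mirror[OF p] by (simp add: in_occurrences_iff)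
    ultimately show ?thesis
      using comp1_closed[of "[f 1, f b, f c, f d]" "f c" "f 1"] by simp
  qed
qed

lemma mirror_occurrence:
  assumes "s \<in> occurrences w"
  obtains t where "t \<in> occurrences w" "set t = f ` set s"
proof -
  from assms obtain c d a b where s: "s = [c, d, a, b]" "pat c d a b"
    by (rule occurrence_cases)
  show ?thesis
    by (rule that[of "[f a, f b, f c, f d]"]) (use pat_mirror s in \<open>auto simp: in_occurrences_iff\<close>)
qed

lemma occurrence_subset: "s \<in> occurrences w \<Longrightarrow> set s \<subseteq> {1..n}"
  by (auto simp: occurrences_eq pat_def)

lemma kernel_cases:
  obtains "kernel w = comp1" "\<And>x. x \<in> kernel w \<Longrightarrow> f x \<in> kernel w"
  | "kernel w = {1, f 1}" "\<And>s. s \<in> occurrences w \<Longrightarrow> 1 \<notin> set s"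
proof (cases "\<exists>s\<in>occurrences w. 1 \<in> set s")
  case True
  then have f1: "f 1 \<in> comp1" using f_one_in_comp1 by blast
  then have eq: "kernel w = comp1" by (auto simp: kernel_eq)
  \<comment> \<open>By reflection the preimage of \<open>comp1\<close> under \<open>f\<close>
    swallows every occurrence it meets, so minimality applies.\<close>
  have "comp1 \<subseteq> {x \<in> {1..n}. f x \<in> comp1}"
  proof (rule comp1_least)
    fix s assume s: "s \<in> occurrences w" "set s \<inter> {x \<in> {1..n}. f x \<in> comp1} \<noteq> {}"
    obtain t where "t \<in> occurrences w" "set t = f ` set s"
      using mirror_occurrence[OF s(1)] by blast
    then show "set s \<subseteq> {x \<in> {1..n}. f x \<in> comp1}"
      using comp1_closed[of t] s occurrence_subset[OF s(1)] by blast
  qed (use f1 n_pos in auto)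
  then show ?thesis using that(1) eq by auto
next
  case False
  then have "comp1 \<subseteq> {1}" by (intro comp1_least) auto
  then show ?thesis using that(2) False one_in_comp1 by (auto simp: kernel_eq)
qed

lemma one_in_kernel: "1 \<in> kernel w" and f_one_in_kernel: "f 1 \<in> kernel w"
  using one_in_comp1 by (auto simp: kernel_eq)

lemma kernel_subset: "kernel w \<subseteq> {1..n}"
  using comp1_subset f_in n_pos by (auto simp: kernel_eq)

lemma kernel_f: "x \<in> kernel w \<Longrightarrow> f x \<in> kernel w"
  by (rule kernel_cases) (use f_f[of 1] n_pos in auto)

lemma kernel_closed:
  assumes "s \<in> occurrences w" "set s \<inter> kernel w \<noteq> {}"
  shows "set s \<subseteq> kernel w"
proof (cases rule: kernel_cases)
  case 1
  then show ?thesis using assms comp1_closed by blast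
next
  case 2
  obtain t where t: "t \<in> occurrences w" "set t = f ` set s"
    using mirror_occurrence[OF assms(1)] by blast
  \<comment> \<open>Otherwise the reflected occurrence \<open>t\<close> would contain
    \<open>f (f 1) = 1\<close>.\<close>
  have "f 1 \<notin> set s"
    using 2(2)[OF t(1)] t(2) f_f[of 1] n_pos by force
  then show ?thesis using assms(2) 2(2)[OF assms(1)] by (auto simp: 2(1))
qed

lemma kernel_least:
  assumes "1 \<in> X" "f 1 \<in> X" "\<And>s. s \<in> occurrences w \<Longrightarrow> set s \<inter> X \<noteq> {} \<Longrightarrow> set s \<subseteq> X"
  shows "kernel w \<subseteq> X"
  using comp1_least[of X] assms by (auto simp: kernel_eq)

lemma filter_kernel:
  "filter (\<lambda>x. x \<in> kernel w) w = map f (filter (\<lambda>x. x \<in> kernel w) [1..<n + 1])"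
  by (rule filter_w[OF kernel_subset kernel_f])

lemma filter_kernel_enum:
  assumes "strict_mono_on {1..m} K" "K ` {1..m} = kernel w"
  shows "filter (\<lambda>x. x \<in> kernel w) [1..<n + 1] = map K [1..<m + 1]"
proof -
  have "filter (\<lambda>x. x \<in> kernel w) [1..<n + 1] = sorted_list_of_set (kernel w)"
    by (rule sorted_distinct_set_unique)
      (use kernel_subset finite_subset[OF kernel_subset] in \<open>auto intro: sorted_wrt_filter simp del: upt.simps\<close>)
  then show ?thesis using strict_mono_on_map_upt[OF assms(1)] assms(2) by simp
qed

text \<open>\<open>K\<close> is the increasing enumeration of the kernel. Since the kernel is closed
  under \<open>f\<close>, it is at once a set of entries and of positions, and the order isomorphism
  says that \<open>K\<close> carries the shape to \<open>f\<close>. The arguments about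
  \<open>psi r\<close> use this form.\<close>

lemma kernel_shape_iff:
  assumes \<rho>: "\<rho> \<in> involutions m"
  shows "kernel_shape w \<rho> \<longleftrightarrow> (\<exists>K. strict_mono_on {1..m} K \<and> K ` {1..m} = kernel w \<and>
    (\<forall>i\<in>{1..m}. f (K i) = K (entry \<rho> i)))"
proof -
  interpret R: involution_word \<rho> m by standard (rule \<rho>)
  have 1: "kernel_shape w \<rho> \<longleftrightarrow> order_isomorphic \<rho> (filter (\<lambda>x. x \<in> kernel w) w)"
    using \<rho> by (auto simp: kernel_shape_def)
  show ?thesis
  proof
    assume "kernel_shape w \<rho>"
    then obtain K where K: "strict_mono_on (set \<rho>) K" "filter (\<lambda>x. x \<in> kernel w) w = map K \<rho>"
      using order_isomorphic_imp_map[OF _ R.distinct_w] 1 by metis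
    have m: "strict_mono_on {1..m} K" using K by (simp add: R.set_w)
    have im: "K ` {1..m} = kernel w"
      using arg_cong[OF K(2), of set] kernel_subset
      unfolding set_filter set_map R.set_w set_w by blast
    have "map f (map K [1..<m + 1]) = map K (map (entry \<rho>) [1..<m + 1])"
      using K(2) filter_kernel filter_kernel_enum[OF m im] R.w_eq by simp
    then have "\<forall>i\<in>{1..m}. f (K i) = K (entry \<rho> i)"
      unfolding map_map map_eq_conv by auto
    then show "\<exists>K. strict_mono_on {1..m} K \<and> K ` {1..m} = kernel w \<and>
      (\<forall>i\<in>{1..m}. f (K i) = K (entry \<rho> i))"
      using m im by blast
  next
    assume "\<exists>K. strict_mono_on {1..m} K \<and> K ` {1..m} = kernel w \<and>
      (\<forall>i\<in>{1..m}. f (K i) = K (entry \<rho> i))"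
    then obtain K where K: "strict_mono_on {1..m} K" "K ` {1..m} = kernel w"
      "\<forall>i\<in>{1..m}. f (K i) = K (entry \<rho> i)" by blast
    have "filter (\<lambda>x. x \<in> kernel w) w = map f (map K [1..<m + 1])"
      using filter_kernel filter_kernel_enum[OF K(1,2)] by simp
    also have "\<dots> = map K (map (entry \<rho>) [1..<m + 1])"
      using K(3) by (auto simp del: upt.simps)
    finally have "filter (\<lambda>x. x \<in> kernel w) w = map K \<rho>"
      by (simp only: R.w_eq[symmetric])
    then show "kernel_shape w \<rho>"
      using 1 order_isomorphic_map[of \<rho> K] K(1) by (simp add: R.set_w)
  qed
qed

lemma kernel_shape_measures:
  assumes "kernel_shape w \<rho>"
  shows "length \<rho> = card (kernel w)" "capacity \<rho> = card (inside (kernel w))"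
proof -
  from assms obtain m where "\<rho> \<in> involutions m"
    and iso: "order_isomorphic \<rho> (filter (\<lambda>x. x \<in> kernel w) w)"
    by (auto simp: kernel_shape_def)
  then interpret R: involution_word \<rho> m by unfold_locales
  obtain K where K: "strict_mono_on (set \<rho>) K" "filter (\<lambda>x. x \<in> kernel w) w = map K \<rho>"
    using order_isomorphic_imp_map[OF iso R.distinct_w] by metis
  have "length \<rho> = length (filter (\<lambda>x. x \<in> kernel w) w)"
    by (simp add: K(2))
  also have "\<dots> = card (set (filter (\<lambda>x. x \<in> kernel w) w))"
    by (rule distinct_card[symmetric]) (simp add: distinct_w)
  also have "set (filter (\<lambda>x. x \<in> kernel w) w) = kernel w"
    using kernel_subset by (auto simp: set_w)
  finally show "length \<rho> = card (kernel w)" .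
  have "capacity \<rho> = capacity (filter (\<lambda>x. x \<in> kernel w) w)"
    using capacity_map[OF K(1)] K(2) by simp
  then show "capacity \<rho> = card (inside (kernel w))"
    by (simp add: capacity_def occurrences_filter inside_def subset_eq)
qed

lemma kernel_shape_unique:
  assumes "kernel_shape w \<rho>" "kernel_shape w \<rho>'"
  shows "\<rho> = \<rho>'"
proof -
  from assms obtain m m' where in_m: "\<rho> \<in> involutions m" "\<rho>' \<in> involutions m'"
    by (auto simp: kernel_shape_def)
  then interpret R: involution_word \<rho> m by unfold_locales
  interpret R': involution_word \<rho>' m' by unfold_locales (rule in_m)
  obtain K where K: "strict_mono_on {1..m} K" "K ` {1..m} = kernel w"
    "\<forall>i\<in>{1..m}. f (K i) = K (entry \<rho> i)"
    using assms(1) kernel_shape_iff in_m by blast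
  obtain K' where K': "strict_mono_on {1..m'} K'" "K' ` {1..m'} = kernel w"
    "\<forall>i\<in>{1..m'}. f (K' i) = K' (entry \<rho>' i)"
    using assms(2) kernel_shape_iff in_m by blast
  note u = strict_mono_on_image_unique[OF K(1) K'(1)]
  have m: "m' = m" using u K K' by metis
  have eq: "K i = K' i" if "i \<in> {1..m}" for i using u(2) that K K' by metis
  show ?thesis
  proof (rule nth_equalityI)
    fix i assume "i < length \<rho>"
    then have i: "Suc i \<in> {1..m}" by (simp add: R.length_w)
    then have "K (entry \<rho> (Suc i)) = K (entry \<rho>' (Suc i))"
      using K(3) K'(3) eq R'.f_in m by metis
    then have "entry \<rho> (Suc i) = entry \<rho>' (Suc i)"
      using strict_mono_on_imp_inj_on[OF K(1)] R.f_in[OF i] R'.f_in[of "Suc i"] i m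
      by (simp add: inj_on_eq_iff)
    then show "\<rho> ! i = \<rho>' ! i" by (simp add: entry_def)
  qed (simp add: R.length_w R'.length_w m)
qed

end

section \<open>Adding an occurrence to a closed set\<close>

text \<open>The ends of an arc may be given in either order, and a degenerate arc crosses nothing;
  so the notion applies to any \<open>x\<close> and \<open>f x\<close>, fixed points
  included.\<close>

definition arcs_cross :: "nat \<Rightarrow> nat \<Rightarrow> nat \<Rightarrow> nat \<Rightarrow> bool" where
  "arcs_cross x x' y y' \<longleftrightarrow>
     min x x' < min y y' \<and> min y y' < max x x' \<and> max x x' < max y y' \<or>
     min y y' < min x x' \<and> min x x' < max y y' \<and> max y y' < max x x'"

text \<open>Primes stand for images under \<open>f\<close>. The conclusion is what allows
  \<open>c'\<close> to replace \<open>c\<close> in the occurrence \<open>[c, d, a, b]\<close>. If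
  \<open>c' < b\<close>, the arc of \<open>c\<close>, crossing neither that of \<open>a\<close> nor
  that of \<open>b\<close>, would enclose both and then cross the arc of \<open>d\<close>, because
  \<open>c' < d' < a' < c < d\<close>. The other two bounds, where not immediate, also come from not
  crossing the arc of \<open>d\<close>.\<close>

lemma flip_lower:
  assumes "a < b" "b < c" "c < d" "c' < d'" "d' < a'" "a' < b'" "b < a'" "c' \<noteq> c"
    and "c \<noteq> a'" "c \<noteq> b'" "c \<noteq> d'" "c' \<noteq> a" "c' \<noteq> b" "c' \<noteq> d"
    and "\<not> arcs_cross c c' a a'" "\<not> arcs_cross c c' b b'" "\<not> arcs_cross c c' d d'"
  shows "b < c' \<and> c' < d \<and> c < d'"
proof -
  have ab: "min a a' = a" "max a a' = a'" "min b b' = b" "max b b' = b'"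
    using assms by (simp_all add: min_def max_def)
  consider "c < c'" "d \<le> d'" | "c < c'" "d' < d" | "c' < c" "d \<le> d'" | "c' < c" "d' < d"
    using assms(8) by linarith
  then show ?thesis
  proof cases
    case 1
    then have m: "min c c' = c" "max c c' = c'" "min d d' = d" "max d d' = d'"
      by (simp_all add: min_def max_def)
    show ?thesis
      using assms(1-14) assms(15-)[unfolded arcs_cross_def ab m] 1 by (simp add: not_less; linarith)
  next
    case 2
    then have m: "min c c' = c" "max c c' = c'" "min d d' = d'" "max d d' = d"
      by (simp_all add: min_def max_def)
    show ?thesis
      using assms(1-14) assms(15-)[unfolded arcs_cross_def ab m] 2 by (simp add: not_less; linarith)
  next
    case 3
    then have m: "min c c' = c'" "max c c' = c" "min d d' = d" "max d d' = d'"
      by (simp_all add: min_def max_def)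
    show ?thesis
      using assms(1-14) assms(15-)[unfolded arcs_cross_def ab m] 3 by (simp add: not_less; linarith)
  next
    case 4
    then have m: "min c c' = c'" "max c c' = c" "min d d' = d'" "max d d' = d"
      by (simp_all add: min_def max_def)
    show ?thesis
      using assms(1-14) assms(15-)[unfolded arcs_cross_def ab m] 4 by (simp add: not_less; linarith)
  qed
qed

text \<open>The same for replacing \<open>d\<close> by \<open>d'\<close>: \<open>c < d'\<close> is
  the order of the entries, and \<open>c' < d < a'\<close> puts the new position \<open>d\<close>
  between those of \<open>c\<close> and \<open>a\<close>.\<close>

lemma flip_upper:
  assumes "a < b" "b < c" "c < d" "c' < d'" "d' < a'" "a' < b'" "b < a'" "d' \<noteq> d"
    and "d \<noteq> a'" "d \<noteq> b'" "d \<noteq> c'" "d' \<noteq> a" "d' \<noteq> b" "d' \<noteq> c"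
    and "\<not> arcs_cross d d' a a'" "\<not> arcs_cross d d' b b'" "\<not> arcs_cross d d' c c'"
  shows "d < a' \<and> c' < d \<and> c < d'"
proof -
  have ab: "min a a' = a" "max a a' = a'" "min b b' = b" "max b b' = b'"
    using assms by (simp_all add: min_def max_def)
  consider "c \<le> c'" "d < d'" | "c \<le> c'" "d' < d" | "c' < c" "d < d'" | "c' < c" "d' < d"
    using assms(8) by linarith
  then show ?thesis
  proof cases
    case 1
    then have m: "min c c' = c" "max c c' = c'" "min d d' = d" "max d d' = d'"
      by (simp_all add: min_def max_def)
    show ?thesis
      using assms(1-14) assms(15-)[unfolded arcs_cross_def ab m] 1 by (simp add: not_less; linarith)
  next
    case 2
    then have m: "min c c' = c" "max c c' = c'" "min d d' = d'" "max d d' = d"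
      by (simp_all add: min_def max_def)
    show ?thesis
      using assms(1-14) assms(15-)[unfolded arcs_cross_def ab m] 2 by (simp add: not_less; linarith)
  next
    case 3
    then have m: "min c c' = c'" "max c c' = c" "min d d' = d" "max d d' = d'"
      by (simp_all add: min_def max_def)
    show ?thesis
      using assms(1-14) assms(15-)[unfolded arcs_cross_def ab m] 3 by (simp add: not_less; linarith)
  next
    case 4
    then have m: "min c c' = c'" "max c c' = c" "min d d' = d'" "max d d' = d"
      by (simp_all add: min_def max_def)
    show ?thesis
      using assms(1-14) assms(15-)[unfolded arcs_cross_def ab m] 4 by (simp add: not_less; linarith)
  qed
qed

context nonempty_involution_word
begin

lemma arcs_cross_obtain:
  assumes "arcs_cross x (f x) y (f y)" "x \<in> {1..n}" "y \<in> {1..n}"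
  obtains i k where "i \<in> {x, f x}" "k \<in> {y, f y}" "i < k" "k < f i" "f i < f k"
  | i k where "i \<in> {y, f y}" "k \<in> {x, f x}" "i < k" "k < f i" "f i < f k"
proof -
  have "\<exists>u\<in>{x, f x}. u < f u \<and> min x (f x) = u \<and> max x (f x) = f u"
    "\<exists>u\<in>{y, f y}. u < f u \<and> min y (f y) = u \<and> max y (f y) = f u"
    using assms f_f[of x] f_f[of y] by (auto simp: arcs_cross_def min_def max_def)
  then show ?thesis
    using assms(1) that unfolding arcs_cross_def by metis
qed

lemma occurrence_of_crossing:
  assumes "arcs_cross x (f x) y (f y)" "x \<in> {1..n}" "y \<in> {1..n}"
  shows "\<exists>s\<in>occurrences w. set s = {x, f x, y, f y}"
proof -
  have *: "\<exists>s\<in>occurrences w. set s = {x, f x, y, f y}"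
    if "i \<in> {x, f x}" "k \<in> {y, f y}" "i < k" "k < f i" "f i < f k" "x \<in> {1..n}" "y \<in> {1..n}" for x y i k
  proof -
    have "i \<in> {1..n}" "k \<in> {1..n}" using that f_in by auto
    then have "[f i, f k, i, k] \<in> occurrences w"
      using pat_crossing that by (simp add: in_occurrences_iff)
    moreover have "set [f i, f k, i, k] = {x, f x, y, f y}"
      using that f_f by auto
    ultimately show ?thesis by blast
  qed
  from assms(1) show ?thesis
  proof (rule arcs_cross_obtain)
    fix i k assume "i \<in> {y, f y}" "k \<in> {x, f x}" "i < k" "k < f i" "f i < f k"
    from *[OF this assms(3,2)] show ?thesis by (auto simp: insert_commute)
  qed (use * assms in blast)+
qed

lemma not_arcs_cross_boundary:
  assumes closed: "\<And>x. x \<in> S \<Longrightarrow> f x \<in> S"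
    and sep: "\<And>i k. i \<in> {1..n} \<Longrightarrow> k \<in> {1..n} \<Longrightarrow> i < k \<Longrightarrow> k < f i \<Longrightarrow> f i < f k \<Longrightarrow> i \<in> S \<longleftrightarrow> k \<in> S"
    and "x \<in> {1..n}" "y \<in> {1..n}" "(x \<in> S) \<noteq> (y \<in> S)"
  shows "\<not> arcs_cross x (f x) y (f y)"
proof
  have fS: "f z \<in> S \<longleftrightarrow> z \<in> S" if "z \<in> {1..n}" for z
    using closed f_f that by metis
  assume "arcs_cross x (f x) y (f y)"
  then show False
    by (rule arcs_cross_obtain) (use sep fS f_in assms(3-5) in \<open>blast+\<close>)
qed

lemma card_inside_add:
  assumes "S \<subseteq> T" "X \<subseteq> occurrences w" "\<And>s. s \<in> X \<Longrightarrow> set s \<subseteq> T \<and> \<not> set s \<subseteq> S"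
  shows "card (inside S) + card X \<le> card (inside T)"
proof -
  have "card (inside S) + card X = card (inside S \<union> X)"
    by (rule card_Un_disjoint[symmetric])
      (use assms finite_inside finite_subset[OF assms(2) finite_occurrences] in \<open>auto simp: inside_def\<close>)
  also have "\<dots> \<le> card (inside T)"
    by (rule card_mono) (use assms finite_inside in \<open>auto simp: inside_def\<close>)
  finally show ?thesis .
qed

lemma card_Un_le_length: "card (S \<union> set xs) \<le> card S + length xs"
  by (meson add_le_mono card_Un_le card_length le_refl le_trans)

text \<open>New entries are weighed against twice the new occurrences. By \<open>sep\<close>,
  \<open>a\<close> and \<open>b\<close> are both inside or both outside \<open>S\<close>. If
  outside, the occurrence, its reflection and the crossing of the arcs of \<open>a\<close> and
  \<open>b\<close> are three occurrences against at most six entries; if inside, the first two stand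
  against at most four entries. The first balance can be even only if \<open>S\<close> contains a
  fixed point, the second never is.\<close>

lemma grow_by_occurrence:
  assumes "S \<subseteq> {1..n}" and closed: "\<And>x. x \<in> S \<Longrightarrow> f x \<in> S"
    and sep: "\<And>i k. i \<in> {1..n} \<Longrightarrow> k \<in> {1..n} \<Longrightarrow> i < k \<Longrightarrow> k < f i \<Longrightarrow> f i < f k \<Longrightarrow> i \<in> S \<longleftrightarrow> k \<in> S"
    and p: "pat c d a b" and cross: "b < f a"
    and meets: "{a, b, c, d} \<inter> S \<noteq> {}" "\<not> {a, b, c, d} \<subseteq> S"
  defines "T \<equiv> S \<union> {a, b, c, d, f a, f b, f c, f d}"
  shows "card T + 2 * card (inside S) \<le> card S + 2 * card (inside T)"
    and "(\<And>x. x \<in> S \<Longrightarrow> f x \<noteq> x) \<Longrightarrow>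
      card T + 2 * card (inside S) < card S + 2 * card (inside T)"
proof -
  have dom: "a \<in> {1..n}" "b \<in> {1..n}" "c \<in> {1..n}" "d \<in> {1..n}"
    and ord: "a < b" "b < c" "c < d" "f c < f d" "f d < f a" "f a < f b"
    using p by (auto simp: pat_def)
  have fS: "f z \<in> S \<longleftrightarrow> z \<in> S" if "z \<in> {1..n}" for z
    using closed f_f that by metis
  have ab: "a \<in> S \<longleftrightarrow> b \<in> S"
    using sep[of a b] dom ord cross by blast
  note nc = not_arcs_cross_boundary[OF closed sep]
  let ?s = "[c, d, a, b]" and ?s' = "[f a, f b, f c, f d]" and ?t = "[f a, f b, a, b]"
  have occ: "?s \<in> occurrences w" "?s' \<in> occurrences w" "?t \<in> occurrences w"
    using p pat_mirror[OF p] pat_crossing[of a b] dom ord cross by (auto simp: in_occurrences_iff)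
  have ST: "S \<subseteq> T" by (auto simp: T_def)
  have TT: "a \<in> T" "b \<in> T" "c \<in> T" "d \<in> T" "f a \<in> T" "f b \<in> T" "f c \<in> T" "f d \<in> T"
    by (simp_all add: T_def)
  have grow: "card (inside S) + card X \<le> card (inside T)"
    if "\<forall>s\<in>X. s \<in> occurrences w \<and> set s \<subseteq> T \<and> \<not> set s \<subseteq> S" for X
    by (rule card_inside_add[OF ST]) (use that in blast)+
  have size: "card T \<le> card S + length xs"
    if "{a, b, c, d, f a, f b, f c, f d} \<subseteq> S \<union> set xs" for xs
  proof -
    have "card T \<le> card (S \<union> set xs)"
      by (rule card_mono) (use that assms(1) finite_subset in \<open>auto simp: T_def\<close>)
    then show ?thesis using card_Un_le_length[of S xs] by linarith
  qed
  have lower: "[f c, d, a, b] \<in> occurrences w"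
    if "f c \<noteq> c" "f c \<notin> {a, b, d}" "\<not> arcs_cross c (f c) a (f a)"
      "\<not> arcs_cross c (f c) b (f b)" "\<not> arcs_cross c (f c) d (f d)"
  proof -
    have "c \<noteq> f a" "c \<noteq> f b" "c \<noteq> f d" "f c \<noteq> a" "f c \<noteq> b" "f c \<noteq> d"
      using that(2) dom f_f by auto
    with flip_lower[OF ord cross that(1) _ _ _ _ _ _ that(3-5)]
    have "b < f c \<and> f c < d \<and> c < f d" by simp
    then show ?thesis
      using dom ord f_in f_f by (simp add: in_occurrences_iff pat_def)
  qed
  have upper: "[c, f d, a, b] \<in> occurrences w"
    if "f d \<noteq> d" "f d \<notin> {a, b, c}" "\<not> arcs_cross d (f d) a (f a)"
      "\<not> arcs_cross d (f d) b (f b)" "\<not> arcs_cross d (f d) c (f c)"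
  proof -
    have "d \<noteq> f a" "d \<noteq> f b" "d \<noteq> f c" "f d \<noteq> a" "f d \<noteq> b" "f d \<noteq> c"
      using that(2) dom f_f by auto
    with flip_upper[OF ord cross that(1) _ _ _ _ _ _ that(3-5)]
    have "d < f a \<and> f c < d \<and> c < f d" by simp
    then show ?thesis
      using dom ord f_in f_f by (simp add: in_occurrences_iff pat_def)
  qed
  have "card T + 2 * card (inside S) \<le> card S + 2 * card (inside T) \<and>
    ((\<forall>x\<in>S. f x \<noteq> x) \<longrightarrow> card T + 2 * card (inside S) < card S + 2 * card (inside T))"
  proof (cases "a \<in> S")
    case False
    then have out: "a \<notin> S" "b \<notin> S" "f a \<notin> S" "f b \<notin> S"
      using ab fS dom by auto
    have cd: "c \<in> S \<or> d \<in> S" using meets(1) out by auto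
    then have cd': "c \<noteq> f a \<or> d \<noteq> f b" using out by metis
    then have "?s \<noteq> ?t" "?s \<noteq> ?s'" by auto
    have "?s' \<noteq> ?t" using cd' dom f_f by (metis list.inject)
    have "card {?s, ?s', ?t} = 3"
      unfolding card_3_iff using \<open>?s \<noteq> ?t\<close> \<open>?s \<noteq> ?s'\<close> \<open>?s' \<noteq> ?t\<close> by blast
    with grow[of "{?s, ?s', ?t}"] have 3: "card (inside S) + 3 \<le> card (inside T)"
      using occ out TT by simp
    consider "c \<in> S" "d \<in> S" | "c \<in> S" "d \<notin> S" | "c \<notin> S" "d \<in> S" using cd by blast
    then show ?thesis
    proof cases
      case 1
      then have "card T \<le> card S + 4"
        using size[of "[a, b, f a, f b]"] closed by simp
      with 3 show ?thesis by simp
    next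
      case 2
      then have 6: "card T \<le> card S + 6"
        using size[of "[a, b, d, f a, f b, f d]"] closed by simp
      \<comment> \<open>Six entries are exactly paid for by three occurrences; moving
        \<open>c\<close> to the other end of its arc yields a fourth.\<close>
      have "card (inside S) + 4 \<le> card (inside T)" if "f c \<noteq> c"
      proof -
        have "[f c, d, a, b] \<in> occurrences w"
          using lower nc[of c] dom out 2 that closed[of c] by auto
        moreover have "[f c, d, a, b] \<notin> {?s, ?s', ?t}" using that ord by auto
        then have "card (insert [f c, d, a, b] {?s, ?s', ?t}) = 4"
          using \<open>card {?s, ?s', ?t} = 3\<close> by (subst card_insert_disjoint) auto
        ultimately show ?thesis
          using grow[of "insert [f c, d, a, b] {?s, ?s', ?t}"] occ out TT by simp
      qed
      with 3 6 show ?thesis using 2 by fastforce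
    next
      case 3
      then have 6: "card T \<le> card S + 6"
        using size[of "[a, b, c, f a, f b, f c]"] closed by simp
      have "card (inside S) + 4 \<le> card (inside T)" if "f d \<noteq> d"
      proof -
        have "[c, f d, a, b] \<in> occurrences w"
          using upper nc[of d] dom out 3 that closed[of d] by auto
        moreover have "[c, f d, a, b] \<notin> {?s, ?s', ?t}" using that ord by auto
        then have "card (insert [c, f d, a, b] {?s, ?s', ?t}) = 4"
          using \<open>card {?s, ?s', ?t} = 3\<close> by (subst card_insert_disjoint) auto
        ultimately show ?thesis
          using grow[of "insert [c, f d, a, b] {?s, ?s', ?t}"] occ out TT by simp
      qed
      with \<open>card (inside S) + 3 \<le> card (inside T)\<close> 6 show ?thesis using 3 by fastforce
    qed
  next
    case True
    then have ins: "a \<in> S" "b \<in> S" "f a \<in> S" "f b \<in> S"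
      using ab fS dom by auto
    have cd: "c \<notin> S \<or> d \<notin> S" using meets(2) ins by auto
    have cd': "f c \<notin> S \<or> f d \<notin> S" using cd fS dom by auto
    have ne: "?s \<noteq> ?s'" using cd ins by auto
    then have "card {?s, ?s'} = 2" by simp
    with grow[of "{?s, ?s'}"] have 2: "card (inside S) + 2 \<le> card (inside T)"
      using occ cd cd' TT by auto
    have ext: "card (inside S) + 3 \<le> card (inside T)"
      if "t \<in> occurrences w" "t \<noteq> ?s" "t \<noteq> ?s'" "set t \<subseteq> T" "\<not> set t \<subseteq> S" for t
    proof -
      have "card {?s, ?s', t} = 3" using that ne by auto
      then show ?thesis
        using grow[of "{?s, ?s', t}"] occ cd cd' TT that by auto
    qed
    \<comment> \<open>Either an entry is saved, as in the first five cases below, or there is a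
      third occurrence: the crossing of the arcs of \<open>c\<close> and \<open>d\<close>, or else
      the given occurrence with \<open>c\<close> moved to the other end of its arc.\<close>
    have 3: "card T \<le> card S + 3 \<or> card (inside S) + 3 \<le> card (inside T)"
    proof -
      consider "c \<in> S" | "d \<in> S" | "f c = c" | "f d = d" | "f c = d"
        | "c \<notin> S" "d \<notin> S" "f c \<noteq> c" "f d \<noteq> d" "arcs_cross c (f c) d (f d)"
        | "c \<notin> S" "d \<notin> S" "f c \<noteq> c" "f d \<noteq> d" "f c \<noteq> d" "\<not> arcs_cross c (f c) d (f d)"
        by blast
      then show ?thesis
      proof cases
        case 1
        \<comment> \<open>The repeated element only pads the list to length three.\<close>
        then show ?thesis using size[of "[d, f d, d]"] closed ins by simp
      next
        case 2
        then show ?thesis using size[of "[c, f c, c]"] closed ins by simp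
      next
        case 3
        then show ?thesis using size[of "[c, d, f d]"] ins by simp
      next
        case 4
        then show ?thesis using size[of "[c, d, f c]"] ins by simp
      next
        case 5
        then show ?thesis using size[of "[c, d, f d]"] ins by simp
      next
        case 6
        have out: "f c \<notin> S" "f d \<notin> S" using 6 fS dom by auto
        obtain i k where ik: "i \<in> {c, f c} \<and> k \<in> {d, f d} \<or> i \<in> {d, f d} \<and> k \<in> {c, f c}"
          "i < k" "k < f i" "f i < f k"
          using arcs_cross_obtain[OF 6(5) dom(3,4)] by metis
        have ik_in: "i \<in> {c, d, f c, f d}" "k \<in> {c, d, f c, f d}"
          "f i \<in> {c, d, f c, f d}" "f k \<in> {c, d, f c, f d}"
          using ik(1) dom f_f by auto
        then have "i \<in> {1..n}" "k \<in> {1..n}" using dom f_in by blast+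
        then have "[f i, f k, i, k] \<in> occurrences w"
          using pat_crossing ik by (simp add: in_occurrences_iff)
        moreover have "i \<notin> S" "f i \<notin> S" using ik_in 6 out by auto
        moreover from this have "f i \<noteq> f a" "i \<noteq> a" using ins by metis+
        moreover have "{i, k, f i, f k} \<subseteq> T"
          using ik_in TT by (intro subsetI) (elim insertE emptyE; simp)
        ultimately show ?thesis
          using ext[of "[f i, f k, i, k]"] by simp
      next
        case 7
        then have "f c \<notin> {a, b, d}" using fS ins dom by auto
        then have "[f c, d, a, b] \<in> occurrences w"
          using lower nc[of c] dom ins 7 by simp
        moreover have "f c \<noteq> f a" using fS[OF dom(3)] 7(1) ins by metis
        ultimately show ?thesis
          using ext[of "[f c, d, a, b]"] 7 TT by simp
      qed
    qed
    have "card T \<le> card S + 4"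
      using size[of "[c, d, f c, f d]"] ins by simp
    with 2 3 show ?thesis by linarith
  qed
  then show "card T + 2 * card (inside S) \<le> card S + 2 * card (inside T)"
    and "(\<And>x. x \<in> S \<Longrightarrow> f x \<noteq> x) \<Longrightarrow>
      card T + 2 * card (inside S) < card S + 2 * card (inside T)" by blast+
qed

end

section \<open>Chains of arcs\<close>

lemma bounded_Suc_mono:
  fixes g :: "nat \<Rightarrow> nat"
  assumes "\<And>i. m \<le> i \<Longrightarrow> i < k \<Longrightarrow> g i < g (Suc i)" "m \<le> i" "i < j" "j \<le> k"
  shows "g i < g j"
  using assms(3,4)
proof (induction j)
  case (Suc j)
  show ?case
  proof (cases "i = j")
    case False
    then have "g i < g j" using Suc by simp
    moreover have "g j < g (Suc j)" using assms(1)[of j] assms(2) Suc.prems by simp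
    ultimately show ?thesis by simp
  qed (use assms(1)[of j] assms(2) Suc.prems in simp)
qed simp

context nonempty_involution_word
begin

text \<open>The left ends of the arcs are \<open>l 0, \<dots>, l k\<close>.\<close>

definition chain :: "nat \<Rightarrow> (nat \<Rightarrow> nat) \<Rightarrow> bool" where
  "chain k l \<longleftrightarrow> l 0 = 1 \<and> (\<forall>i\<le>k. l i \<in> {1..n} \<and> l i < f (l i)) \<and>
     (\<forall>i<k. l i < l (Suc i) \<and> l (Suc i) < f (l i) \<and> f (l i) < f (l (Suc i))) \<and>
     (\<forall>i. i + 2 \<le> k \<longrightarrow> f (l i) < l (i + 2))"

definition arcs :: "nat \<Rightarrow> (nat \<Rightarrow> nat) \<Rightarrow> nat set" where
  "arcs k l = l ` {..k} \<union> (\<lambda>i. f (l i)) ` {..k}"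

lemma chain_card_inside:
  assumes "chain k l"
  shows "k \<le> card (inside (arcs k l))"
proof -
  let ?o = "\<lambda>i. [f (l i), f (l (Suc i)), l i, l (Suc i)]"
  have mono: "l i < l j" if "i < j" "j \<le> k" for i j
    by (rule bounded_Suc_mono[of 0 k]) (use assms that in \<open>auto simp: chain_def\<close>)
  have "inj_on ?o {..<k}"
    by (rule inj_onI) (metis lessThan_iff less_imp_le linorder_cases list.inject mono order.irrefl)
  moreover have "?o ` {..<k} \<subseteq> inside (arcs k l)"
  proof (rule image_subsetI)
    fix i assume "i \<in> {..<k}"
    then have "pat (f (l i)) (f (l (Suc i))) (l i) (l (Suc i))"
      using assms by (intro pat_crossing) (auto simp: chain_def)
    then show "?o i \<in> inside (arcs k l)"
      using \<open>i \<in> {..<k}\<close> by (auto simp: inside_def in_occurrences_iff arcs_def)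
  qed
  ultimately show ?thesis
    using card_inj_on_le[OF _ _ finite_inside] by fastforce
qed

lemma card_arcs_le: "card (arcs k l) \<le> 2 * k + 2"
proof -
  have "card (arcs k l) \<le> card (l ` {..k}) + card ((\<lambda>i. f (l i)) ` {..k})"
    unfolding arcs_def by (rule card_Un_le)
  also have "\<dots> \<le> card {..k} + card {..k}"
    by (intro add_mono card_image_le) auto
  finally show ?thesis by simp
qed

lemma chain_f_ne:
  assumes "chain k l" "x \<in> arcs k l"
  shows "f x \<noteq> x"
  using assms f_f by (fastforce simp: chain_def arcs_def)

text \<open>If the arcs of \<open>x\<close> and \<open>y\<close> cross, they form the occurrence.
  Otherwise one encloses the other, and the arc of \<open>z\<close>, crossing both, leads from
  outside the outer arc to inside the inner one; both its ends and one end of each of the other arcs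
  form an occurrence.\<close>

lemma occurrence_of_three_arcs:
  assumes dom: "x \<in> {1..n}" "y \<in> {1..n}" "z \<in> {1..n}"
    and "x < f x" "y < f y" "z < f z" "x \<noteq> y" "arcs_cross x (f x) z (f z)" "arcs_cross y (f y) z (f z)"
    and "y < f x" "x < f y"
  shows "\<exists>s\<in>occurrences w. set s \<subseteq> {x, f x, y, f y, z, f z} \<and>
    set s \<inter> {x, f x} \<noteq> {} \<and> set s \<inter> {y, f y} \<noteq> {}"
proof -
  have main: "\<exists>s\<in>occurrences w. set s \<subseteq> {x, f x, y, f y, z, f z} \<and>
    set s \<inter> {x, f x} \<noteq> {} \<and> set s \<inter> {y, f y} \<noteq> {}"
    if dom: "x \<in> {1..n}" "y \<in> {1..n}" "z \<in> {1..n}"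
      and ord: "x < f x" "y < f y" "z < f z" "x < y" "y < f x"
      and cr: "arcs_cross x (f x) z (f z)" "arcs_cross y (f y) z (f z)" for x y z
  proof -
    note fd = f_in[OF dom(1)] f_in[OF dom(2)] f_in[OF dom(3)] f_f[OF dom(1)] f_f[OF dom(2)] f_f[OF dom(3)]
    have "f x \<noteq> f y" using f_eq_iff dom ord by auto
    have cr': "z < x \<and> x < f z \<and> f z < f x \<or> x < z \<and> z < f x \<and> f x < f z"
      "z < y \<and> y < f z \<and> f z < f y \<or> y < z \<and> z < f y \<and> f y < f z"
      using cr ord by (auto simp: arcs_cross_def min_def max_def)
    consider "f x < f y" | "f y < f x" "z < x" | "f y < f x" "x < z"
      using \<open>f x \<noteq> f y\<close> cr' by linarith
    then show ?thesis
    proof cases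
      case 1
      then have "pat (f x) (f y) x y" using pat_crossing dom ord by simp
      then show ?thesis by (intro bexI[of _ "[f x, f y, x, y]"]) (auto simp: in_occurrences_iff)
    next
      case 2
      then have "x < f z" "f z < f y" "y < f z" using cr' ord by linarith+
      then have "pat (f z) (f y) z x"
        using dom fd ord 2 by (simp add: pat_def)
      then show ?thesis by (intro bexI[of _ "[f z, f y, z, x]"]) (auto simp: in_occurrences_iff)
    next
      case 3
      then have "y < z" "z < f y" "z < f x" "f x < f z" using cr' ord by linarith+
      then have "pat (f x) (f z) y z"
        using dom fd ord 3 by (simp add: pat_def)
      then show ?thesis by (intro bexI[of _ "[f x, f z, y, z]"]) (auto simp: in_occurrences_iff)
    qed
  qed
  show ?thesis
  proof (cases "x < y")
    case True
    from main[OF dom assms(4-6) this assms(10,8,9)] show ?thesis .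
  next
    case False
    then have "y < x" using assms by simp
    from main[OF dom(2,1,3) assms(5,4,6) this assms(11,9,8)]
    show ?thesis by (auto simp: insert_commute)
  qed
qed

text \<open>The crossing with the arc of \<open>l j\<close> uses up the single occurrence allowed by
  \<open>few\<close>. By \<open>occurrence_of_three_arcs\<close>, the new arc must then be disjoint
  from the neighbours of that arc in the chain. As nothing starts before \<open>l 0 = 1\<close>, it
  fits only behind the last arc.\<close>

lemma extend_chain:
  assumes chain: "chain k l" and S: "S = arcs k l" and closed: "\<And>x. x \<in> S \<Longrightarrow> f x \<in> S"
    and p: "p \<in> {1..n}" "p < f p" "p \<notin> S"
    and j: "j \<le> k" and cross: "arcs_cross p (f p) (l j) (f (l j))"
    and few: "card (inside (S \<union> {p, f p})) \<le> Suc (card (inside S))"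
  shows "chain (Suc k) (l(Suc k := p)) \<and> arcs (Suc k) (l(Suc k := p)) = S \<union> {p, f p}"
proof -
  have l: "l i \<in> {1..n}" "l i < f (l i)" if "i \<le> k" for i
    using chain that by (auto simp: chain_def)
  have next_arc: "l i < l (Suc i)" "l (Suc i) < f (l i)" "f (l i) < f (l (Suc i))" if "i < k" for i
    using chain that by (auto simp: chain_def)
  have fp: "f p \<notin> S"
    using closed[of "f p"] p f_f[of p] by auto
  have ne: "p \<noteq> l i" "p \<noteq> f (l i)" "f p \<noteq> l i" "f p \<noteq> f (l i)" if "i \<le> k" for i
    using p fp that by (auto simp: S arcs_def)
  have j_cross: "p < l j \<and> l j < f p \<and> f p < f (l j) \<or> l j < p \<and> p < f (l j) \<and> f (l j) < f p"
    using cross p l[OF j] by (auto simp: arcs_cross_def min_def max_def)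
  have first: "\<exists>s\<in>occurrences w. set s = {p, f p, l j, f (l j)}"
    using occurrence_of_crossing[OF cross p(1) l(1)[OF j]] .
  have l_inj: "l i \<noteq> f (l i')" "i \<noteq> i' \<Longrightarrow> l i \<noteq> l i'" "i \<noteq> i' \<Longrightarrow> f (l i) \<noteq> f (l i')"
    if "i \<le> k" "i' \<le> k" for i i'
  proof -
    have mono: "l a < l b" if "a < b" "b \<le> k" for a b
      by (rule bounded_Suc_mono[of 0 k]) (use chain that in \<open>auto simp: chain_def\<close>)
    show "i \<noteq> i' \<Longrightarrow> l i \<noteq> l i'" using mono that by (metis linorder_neqE_nat order.irrefl)
    then show "i \<noteq> i' \<Longrightarrow> f (l i) \<noteq> f (l i')" using f_eq_iff l that by blast
    show "l i \<noteq> f (l i')"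
      using l[OF that(1)] l[OF that(2)] f_f[of "l i'"] by auto
  qed
  have separated: "f p < l i \<or> f (l i) < p"
    if i: "i \<le> k" "i \<noteq> j" "arcs_cross (l i) (f (l i)) (l j) (f (l j))" for i
  proof (rule ccontr)
    assume "\<not> ?thesis"
    then have "l i < f p" "p < f (l i)" using ne[OF i(1)] by force+
    then obtain s where s: "s \<in> occurrences w" "set s \<subseteq> {p, f p, l i, f (l i), l j, f (l j)}"
      "set s \<inter> {p, f p} \<noteq> {}" "set s \<inter> {l i, f (l i)} \<noteq> {}"
      using occurrence_of_three_arcs[of p "l i" "l j"] p l[OF i(1)] l[OF j] ne[OF i(1)] cross i(3)
      by auto
    obtain t where t: "t \<in> occurrences w" "set t = {p, f p, l j, f (l j)}" using first by blast
    \<comment> \<open>\<open>s\<close> contains an end of the arc of \<open>l i\<close> and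
      \<open>t\<close> does not, so there would be two new occurrences.\<close>
    have "{l i, f (l i)} \<inter> set t = {}"
      using l_inj i j ne[OF i(1)] l_inj[OF j i(1)] by (auto simp: t)
    then have "s \<noteq> t" using s by blast
    have "card (inside S) + card {s, t} \<le> card (inside (S \<union> {p, f p}))"
    proof (rule card_inside_add)
      fix u assume "u \<in> {s, t}"
      moreover have "{l i, f (l i), l j, f (l j)} \<subseteq> S"
        using i j by (auto simp: S arcs_def)
      ultimately show "set u \<subseteq> S \<union> {p, f p} \<and> \<not> set u \<subseteq> S"
        using s t p fp by auto
    qed (use s t in auto)
    with few \<open>s \<noteq> t\<close> show False by simp
  qed
  have l0: "l 0 = 1" using chain by (simp add: chain_def)
  have cross_next: "arcs_cross (l i) (f (l i)) (l (Suc i)) (f (l (Suc i)))" if "i < k" for i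
    using next_arc[OF that] l[of i] l[of "Suc i"] that by (auto simp: arcs_cross_def min_def max_def)
  have cross_prev: "arcs_cross (l (Suc i)) (f (l (Suc i))) (l i) (f (l i))" if "i < k" for i
    using cross_next[OF that] by (auto simp: arcs_cross_def)
  have prev: "f (l i) < p" if "j = Suc i" for i
    using separated[of i] cross_next[of i] j that j_cross next_arc[of i] by force
  \<comment> \<open>Starting left of \<open>l j\<close>, the new arc would meet the preceding arc,
    which ends right of \<open>l j\<close>; for \<open>j = 0\<close> there is no room left of
    1.\<close>
  have "l j < p"
  proof (rule ccontr)
    assume "\<not> l j < p"
    then have "p < l j" using ne[OF j] by force
    show False
    proof (cases j)
      case 0
      then show ?thesis using \<open>p < l j\<close> l0 p by simp
    next
      case (Suc i)
      then show ?thesis using prev[of i] \<open>p < l j\<close> next_arc[of i] j by simp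
    qed
  qed
  then have p_pos: "l j < p" "p < f (l j)" "f (l j) < f p" using j_cross by auto
  \<comment> \<open>Otherwise the new arc and the next arc of the chain overlap, both passing over
    \<open>f (l j)\<close>.\<close>
  have "j = k"
  proof (rule ccontr)
    assume "j \<noteq> k"
    then have "j < k" using j by simp
    then show False
      using separated[of "Suc j"] cross_prev[of j] next_arc[of j] p_pos by auto
  qed
  have "chain (Suc k) (l(Suc k := p))"
    unfolding chain_def
  proof (intro conjI allI impI)
    fix i assume "i + 2 \<le> Suc k"
    then consider "i + 2 \<le> k" | "Suc i = k" by linarith
    then show "f ((l(Suc k := p)) i) < (l(Suc k := p)) (i + 2)"
    proof cases
      case 1
      then show ?thesis using chain by (simp add: chain_def)
    next
      case 2
      then show ?thesis using prev[of i] \<open>j = k\<close> by auto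
    qed
  qed (use l0 l p next_arc p_pos \<open>j = k\<close> in \<open>auto simp: less_Suc_eq le_Suc_eq\<close>)
  moreover have "arcs (Suc k) (l(Suc k := p)) = S \<union> {p, f p}"
    unfolding arcs_def S by (auto simp: atMost_Suc)
  ultimately show ?thesis by blast
qed

text \<open>The bound \<open>2 * card (inside S) + 2\<close> may be attained only by chains. The
  bound and the form of the sets attaining it are carried together, because the strict loss in a
  later step relies on a tight set having no fixed points.\<close>

definition good :: "nat set \<Rightarrow> bool" where
  "good S \<longleftrightarrow> S \<subseteq> kernel w \<and> (\<forall>x\<in>S. f x \<in> S) \<and> {1, f 1} \<subseteq> S \<and>
     (card S \<le> 2 * card (inside S) + 1 \<or> (\<exists>k l. chain k l \<and> S = arcs k l))"

lemma good_card_le: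
  assumes "good S"
  shows "card S \<le> 2 * card (inside S) + 2"
  using assms card_arcs_le chain_card_inside unfolding good_def
  by (smt (verit, ccfv_threshold) add_le_mono1 le_trans mult_le_mono2 add_leD1 nat_add_left_cancel_le one_le_numeral)

text \<open>If an outside arc crosses \<open>S\<close>, that arc is added, and if the balance stays
  tight, \<open>extend_chain\<close> applies. If none does, \<open>grow_by_occurrence\<close>
  applies and the new set is never tight, since a chain has no fixed points.\<close>

lemma good_grow:
  assumes good: "good S" and "S \<noteq> kernel w"
  shows "\<exists>T. good T \<and> S \<subset> T"
proof -
  have Sk: "S \<subseteq> kernel w" and closed: "\<And>x. x \<in> S \<Longrightarrow> f x \<in> S" and one: "1 \<in> S" "f 1 \<in> S"
    using good by (auto simp: good_def)
  have Sn: "S \<subseteq> {1..n}" using Sk kernel_subset by blast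
  then have finS: "finite S" using finite_subset by blast
  have fS: "f z \<in> S \<longleftrightarrow> z \<in> S" if "z \<in> {1..n}" for z
    using closed f_f that by metis
  show ?thesis
  proof (cases "\<exists>i k. i \<in> {1..n} \<and> k \<in> {1..n} \<and> i < k \<and> k < f i \<and> f i < f k \<and> (i \<in> S) \<noteq> (k \<in> S)")
    case True
    then obtain i k where ik: "i \<in> {1..n}" "k \<in> {1..n}" "i < k" "k < f i" "f i < f k"
      "(i \<in> S) \<noteq> (k \<in> S)" by blast
    have s: "[f i, f k, i, k] \<in> occurrences w"
      using pat_crossing ik by (simp add: in_occurrences_iff)
    then have sk: "{f i, f k, i, k} \<subseteq> kernel w"
      using kernel_closed[OF s] ik(6) Sk by auto
    obtain p q where pq: "p \<notin> S" "q \<in> S" "{p, q} = {i, k}"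
      using ik(6) by (metis insert_commute)
    have p: "p \<in> {1..n}" "p < f p" "q < f q" "{p, f p} \<subseteq> kernel w"
      using pq(3) ik sk by (auto simp: doubleton_eq_iff)
    have cross: "arcs_cross p (f p) q (f q)"
      using pq(3) ik by (auto simp: doubleton_eq_iff arcs_cross_def min_def max_def)
    let ?T = "S \<union> {p, f p}"
    have 1: "card (inside S) + 1 \<le> card (inside ?T)"
      using card_inside_add[of S ?T "{[f i, f k, i, k]}"] s pq fS[of p] p closed
      by (auto simp: doubleton_eq_iff)
    have 2: "card ?T \<le> card S + 2"
      using card_Un_le_length[of S "[p, f p]"] by simp
    have "card ?T \<le> 2 * card (inside ?T) + 1 \<or> (\<exists>k l. chain k l \<and> ?T = arcs k l)"
    proof (cases "card S \<le> 2 * card (inside S) + 1 \<or> card (inside S) + 2 \<le> card (inside ?T)")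
      case True
      then show ?thesis using 1 2 good_card_le[OF good] by linarith
    next
      case False
      then obtain k l where kl: "chain k l" "S = arcs k l" using good by (auto simp: good_def)
      then obtain j where "j \<le> k" "q = l j"
        using pq(2) p(3) f_f unfolding arcs_def chain_def by fastforce
      then show ?thesis
        using extend_chain[OF kl closed p(1,2) pq(1), of j] cross False by auto
    qed
    then have "good ?T"
      using Sk p one closed f_f[of p] by (auto simp: good_def)
    then show ?thesis using pq by blast
  next
    case False
    then have sep: "i \<in> S \<longleftrightarrow> k \<in> S" if "i \<in> {1..n}" "k \<in> {1..n}" "i < k" "k < f i" "f i < f k" for i k
      using that by blast
    obtain s where s: "s \<in> occurrences w" "set s \<inter> S \<noteq> {}" "\<not> set s \<subseteq> S"
      using kernel_least[OF one] assms(2) Sk by blast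
    \<comment> \<open>Up to reflection, which preserves \<open>S\<close>, the crossing arcs are
      those of the two lower entries.\<close>
    obtain c d a b where cdab: "pat c d a b" "b < f a" "{a, b, c, d} \<inter> S \<noteq> {}" "\<not> {a, b, c, d} \<subseteq> S"
    proof -
      obtain c d a b where *: "s = [c, d, a, b]" "pat c d a b"
        using occurrence_cases[OF s(1)] by blast
      have dom: "a \<in> {1..n}" "b \<in> {1..n}" "c \<in> {1..n}" "d \<in> {1..n}"
        using * by (auto simp: pat_def)
      from *(2) show ?thesis
      proof (cases rule: pat_crossing_cases)
        case 1
        then show ?thesis using that * s by (auto simp: insert_commute)
      next
        case 2
        have "{f c, f d, f a, f b} \<inter> S \<noteq> {}" "\<not> {f c, f d, f a, f b} \<subseteq> S"
          using s * fS dom by auto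
        then show ?thesis
          using that[of "f a" "f b" "f c" "f d"] pat_mirror[OF *(2)] 2 f_f dom by simp
      qed
    qed
    define T where "T = S \<union> {a, b, c, d, f a, f b, f c, f d}"
    have dom: "a \<in> {1..n}" "b \<in> {1..n}" "c \<in> {1..n}" "d \<in> {1..n}"
      using cdab by (auto simp: pat_def)
    have "set [c, d, a, b] \<subseteq> kernel w"
      by (rule kernel_closed) (use cdab Sk in \<open>auto simp: in_occurrences_iff\<close>)
    then have Tk: "T \<subseteq> kernel w" using Sk kernel_f by (auto simp: T_def)
    have Tf: "\<forall>x\<in>T. f x \<in> T" using closed f_f dom by (auto simp: T_def)
    note grow = grow_by_occurrence[OF Sn closed sep cdab, folded T_def]
    have "card T \<le> 2 * card (inside T) + 1"
    proof (cases "card S \<le> 2 * card (inside S) + 1")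
      case True
      then show ?thesis using grow(1) by linarith
    next
      case False
      then obtain k l where kl: "chain k l" "S = arcs k l" using good by (auto simp: good_def)
      then show ?thesis
        using grow(2) chain_f_ne[OF kl(1)] good_card_le[OF good] by fastforce
    qed
    then have "good T" using Tk Tf one by (auto simp: good_def T_def)
    moreover have "S \<subset> T" using cdab by (auto simp: T_def)
    ultimately show ?thesis by blast
  qed
qed

lemma good_initial: "good {1, f 1}"
proof -
  have 1: "{1, f 1} \<subseteq> kernel w" using one_in_kernel f_one_in_kernel by simp
  have 2: "f (f 1) = 1" using f_f n_pos by simp
  show ?thesis
  proof (cases "f 1 = 1")
    case True
    then show ?thesis using 1 by (simp add: good_def)
  next
    case False
    then have "chain 0 (\<lambda>_. 1)" using f_in[of 1] n_pos by (auto simp: chain_def)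
    moreover have "{1, f 1} = arcs 0 (\<lambda>_. 1)" by (auto simp: arcs_def)
    ultimately have "\<exists>k l. chain k l \<and> {1, f 1} = arcs k l" by blast
    then show ?thesis using 1 2 by (simp add: good_def)
  qed
qed

theorem good_kernel: "good (kernel w)"
proof -
  have "finite {S. good S}"
    by (rule finite_subset[of _ "Pow {1..n}"]) (use kernel_subset in \<open>auto simp: good_def\<close>)
  then obtain S where "good S" "\<And>T. good T \<Longrightarrow> S \<subseteq> T \<Longrightarrow> S = T"
    using finite_has_maximal[of "{S. good S}"] good_initial by blast
  then show ?thesis using good_grow by blast
qed

text \<open>The cardinality excludes the first alternative of \<open>good\<close>; then
  \<open>card_arcs_le\<close> and \<open>chain_card_inside\<close> squeeze \<open>k\<close> to
  \<open>r\<close>.\<close>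

lemma extremal_kernel_chain:
  assumes "card (inside (kernel w)) = r" "card (kernel w) = 2 * r + 2"
  obtains l where "chain r l" "kernel w = arcs r l"
proof -
  obtain k l where kl: "chain k l" "kernel w = arcs k l"
    using good_kernel assms by (auto simp: good_def)
  then have "k = r"
    using card_arcs_le[of k l] chain_card_inside[OF kl(1)] assms by simp
  then show ?thesis using that kl by blast
qed

end

section \<open>Involutions with kernel shape \<open>\<psi>\<^sup>r\<close>\<close>

text \<open>The ends of the \<open>k\<close>-th arc of \<open>\<psi>\<^sup>r\<close> from the left, \<open>k \<le> r\<close>; the maximum and the minimum
  correct the general formulas for the first and the last arc.\<close>

definition psi_left :: "nat \<Rightarrow> nat" where
  "psi_left k = max 1 (2 * k)"

definition psi_right :: "nat \<Rightarrow> nat \<Rightarrow> nat" where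
  "psi_right r k = min (2 * r + 2) (2 * k + 3)"

lemma entry_psi_left: "k \<le> r \<Longrightarrow> entry (psi r) (psi_left k) = psi_right r k"
  and entry_psi_right: "k \<le> r \<Longrightarrow> entry (psi r) (psi_right r k) = psi_left k"
proof -
  assume k: "k \<le> r"
  have "entry (psi r) (psi_left k) = psi_right r k \<and> entry (psi r) (psi_right r k) = psi_left k"
  proof (cases "r \<ge> 2")
    case True
    then have "entry (psi r) (psi_left k) = psi_entry r (psi_left k)"
      "entry (psi r) (psi_right r k) = psi_entry r (psi_right r k)"
      using k by (intro entry_psi; simp add: psi_left_def psi_right_def)+
    moreover consider "k = 0" | "k = r" "0 < k" | "0 < k" "k < r" using k by linarith
    then have "psi_entry r (psi_left k) = psi_right r k \<and> psi_entry r (psi_right r k) = psi_left k"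
    proof cases
      case 3
      then have "psi_left k = 2 * k" "psi_right r k = 2 * k + 3"
        by (simp_all add: psi_left_def psi_right_def)
      then show ?thesis using 3 True by (simp add: psi_entry_def) presburger
    qed (use True in \<open>auto simp: psi_left_def psi_right_def psi_entry_def min_def max_def\<close>)
    ultimately show ?thesis by simp
  next
    case False
    then consider "r = 0" "k = 0" | "r = 1" "k = 0" | "r = 1" "k = 1" using k by linarith
    then show ?thesis
      by cases (simp_all add: psi_def psi_left_def psi_right_def entry_def numeral_eq_Suc)
  qed
  then show "entry (psi r) (psi_left k) = psi_right r k" "entry (psi r) (psi_right r k) = psi_left k"
    by auto
qed

lemma psi_index_cases:
  assumes "j \<in> {1..2 * r + 2}"
  obtains k where "k \<le> r" "j = psi_left k" "entry (psi r) j = psi_right r k"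
  | k where "k \<le> r" "j = psi_right r k" "entry (psi r) j = psi_left k"
proof -
  have "(\<exists>k\<le>r. j = psi_left k) \<or> (\<exists>k\<le>r. j = psi_right r k)"
  proof -
    \<comment> \<open>Even indices \<open>2 k\<close> are left ends and odd indices
      \<open>2 k + 3\<close> right ends; the exceptions are 1 and \<open>2 r + 2\<close>.\<close>
    have "j = 1 \<or> j = 2 * (j div 2) \<and> 1 \<le> j div 2 \<and> j div 2 \<le> r \<or> j = 2 * r + 2
      \<or> j = 2 * ((j - 3) div 2) + 3 \<and> (j - 3) div 2 < r"
      using assms unfolding atLeastAtMost_iff by presburger
    then consider "j = 1" | k where "j = 2 * k" "1 \<le> k" "k \<le> r" | "j = 2 * r + 2"
      | k where "j = 2 * k + 3" "k < r"
      by blast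
    then show ?thesis
    proof cases
      case 1
      then show ?thesis by (auto simp: psi_left_def intro!: disjI1 exI[of _ 0])
    next
      case (2 k)
      then show ?thesis by (auto simp: psi_left_def intro!: disjI1 exI[of _ k])
    next
      case 3
      then show ?thesis by (auto simp: psi_right_def intro!: disjI2 exI[of _ r])
    next
      case (4 k)
      then show ?thesis by (auto simp: psi_right_def intro!: disjI2 exI[of _ k])
    qed
  qed
  then show ?thesis using that entry_psi_left entry_psi_right by blast
qed

lemma psi_left_in: "k \<le> r \<Longrightarrow> psi_left k \<in> {1..2 * r + 2}"
  and psi_right_in: "k \<le> r \<Longrightarrow> psi_right r k \<in> {1..2 * r + 2}"
  by (auto simp: psi_left_def psi_right_def)

lemma involutionsI:
  assumes "length w = n" "\<And>i. i \<in> {1..n} \<Longrightarrow> entry w i \<in> {1..n} \<and> entry w (entry w i) = i"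
  shows "w \<in> involutions n"
proof -
  have "inj_on (entry w) {1..n}" by (metis assms(2) inj_onI)
  then have im: "entry w ` {1..n} = {1..n}"
    using assms(2) by (intro endo_inj_surj) auto
  have eq: "w = map (entry w) [1..<n + 1]"
    by (rule nth_equalityI) (auto simp: assms(1) entry_def nth_append simp del: upt.simps)
  have set: "set w = {1..n}"
    by (subst eq) (use im in \<open>simp add: atLeastLessThanSuc_atLeastAtMost del: upt.simps\<close>)
  then have "distinct w" using assms(1) by (simp add: card_distinct)
  then show ?thesis using set assms(2) by (auto simp: involutions_def permutations_of_set_def)
qed

lemma psi_entry_in: "j \<in> {1..2 * r + 2} \<Longrightarrow> entry (psi r) j \<in> {1..2 * r + 2}"
  by (rule psi_index_cases) (use psi_left_in psi_right_in in auto)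

lemma psi_involution: "psi r \<in> involutions (2 * r + 2)"
proof (rule involutionsI)
  fix j assume j: "j \<in> {1..2 * r + 2}"
  then show "entry (psi r) j \<in> {1..2 * r + 2} \<and> entry (psi r) (entry (psi r) j) = j"
    by (rule psi_index_cases)
      (use psi_entry_in[OF j] entry_psi_left entry_psi_right in auto)
qed (rule length_psi)

text \<open>Arcs at distance two or more are disjoint, because
  \<open>2 k + 3 < 2 (k + 2)\<close>.\<close>

lemma psi_crossing:
  assumes "i \<in> {1..2 * r + 2}" "j \<in> {1..2 * r + 2}" "i < j" "j < entry (psi r) i"
    "entry (psi r) i < entry (psi r) j"
  shows "\<exists>k<r. i = psi_left k \<and> j = psi_left (Suc k)"
proof -
  from assms(1) obtain k where k: "k \<le> r" "i = psi_left k" "entry (psi r) i = psi_right r k"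
  proof (cases rule: psi_index_cases)
    case (2 k)
    then have "entry (psi r) i < i" by (auto simp: psi_left_def psi_right_def)
    then show ?thesis using assms by simp
  qed
  from assms(2) obtain k' where k': "k' \<le> r" "j = psi_left k'" "entry (psi r) j = psi_right r k'"
  proof (cases rule: psi_index_cases)
    case (2 k)
    then have "entry (psi r) j < j" by (auto simp: psi_left_def psi_right_def)
    then show ?thesis using assms by simp
  qed
  have "k' = Suc k"
    using assms(3-5) k k' unfolding psi_left_def psi_right_def by (auto simp: min_def max_def split: if_splits)
  then show ?thesis using k k' by (intro exI[of _ k]) simp
qed

text \<open>The hypotheses say that \<open>j\<close> is the right end of an arc passing over the
  space between \<open>2 k + 2\<close> and \<open>2 k + 3\<close>; only the arcs \<open>k\<close>
  and \<open>k + 1\<close> do.\<close>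

lemma psi_double_gap:
  assumes "j \<in> {1..2 * r + 2}" "k < r" "2 * k + 2 < j" "entry (psi r) j < 2 * k + 3"
  shows "j = psi_right r k \<or> j = psi_right r (Suc k)"
  using assms(1)
proof (cases rule: psi_index_cases)
  case (1 i)
  then show ?thesis using assms by (auto simp: psi_left_def psi_right_def)
next
  case (2 i)
  then have "i = k \<or> i = Suc k" using assms by (auto simp: psi_left_def psi_right_def)
  then show ?thesis using 2 by auto
qed

text \<open>The gap behind \<open>2 k + 1\<close> lies under arc \<open>k\<close> alone, the gap
  behind \<open>2 k + 2\<close> with \<open>k < r\<close> under the arcs \<open>k\<close> and
  \<open>k + 1\<close>, the last gap under none; these sets of arcs are distinct.\<close>

lemma psi_separates:
  assumes "i \<in> {1..2 * r + 2}" "j \<in> {1..2 * r + 2}" "i < j"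
  shows "\<exists>k\<le>r. (psi_left k \<le> i \<and> i < psi_right r k) \<noteq> (psi_left k \<le> j \<and> j < psi_right r k)"
proof -
  have "i = 2 * ((i - 2) div 2) + 2 \<and> (i - 2) div 2 < r \<or> i = 2 * r + 2
    \<or> i = 2 * ((i - 1) div 2) + 1 \<and> (i - 1) div 2 \<le> r"
    using assms(1) unfolding atLeastAtMost_iff by presburger
  then consider k where "i = 2 * k + 2" "k < r" | "i = 2 * r + 2" | k where "i = 2 * k + 1" "k \<le> r"
    by blast
  then show ?thesis
  proof cases
    case (1 k)
    then show ?thesis using assms
      by (intro exI[of _ k]) (auto simp: psi_left_def psi_right_def)
  next
    case 2
    then show ?thesis using assms by simp
  next
    case (3 k)
    show ?thesis
    proof (cases "j = Suc i \<and> k < r")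
      case True
      then show ?thesis using assms 3
        by (intro exI[of _ "Suc k"]) (auto simp: psi_left_def psi_right_def)
    next
      case False
      then show ?thesis using assms 3
        by (intro exI[of _ k]) (auto simp: psi_left_def psi_right_def)
    qed
  qed
qed

lemma interval_exists:
  fixes K :: "nat \<Rightarrow> nat"
  assumes "K 1 \<le> x" "x < K (Suc m)"
  shows "\<exists>i\<in>{1..m}. K i \<le> x \<and> x < K (Suc i)"
  using assms(2)
proof (induction m)
  case (Suc m)
  show ?case
  proof (cases "x < K (Suc m)")
    case True
    then show ?thesis using Suc.IH by fastforce
  next
    case False
    then show ?thesis using Suc.prems by (intro bexI[of _ "Suc m"]) auto
  qed
qed (use assms(1) in simp)

lemma interval_unique:
  fixes K :: "nat \<Rightarrow> nat"
  assumes "strict_mono_on {1..Suc m} K" "i \<in> {1..m}" "j \<in> {1..m}"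
    "K i \<le> x" "x < K (Suc i)" "K j \<le> x" "x < K (Suc j)"
  shows "i = j"
proof -
  have "K (Suc a) \<le> K b" if "a < b" "a \<in> {1..m}" "b \<in> {1..m}" for a b
    using strict_mono_on_leD[OF assms(1), of "Suc a" b] that by simp
  then show ?thesis using assms(2-) by (metis leD le_less_trans linorder_neqE_nat)
qed

context nonempty_involution_word
begin

text \<open>The chain conditions order the ends as
  \<open>l 0 < l 1 < f (l 0) < l 2 < f (l 1) < ...\<close>, just as the ends of the arcs of
  \<open>psi r\<close> are ordered.\<close>

lemma chain_kernel_shape:
  assumes chain: "chain r l" and ker: "kernel w = arcs r l"
  shows "kernel_shape w (psi r)"
proof -
  \<comment> \<open>This inverts the formulas for \<open>psi_left\<close> and
    \<open>psi_right\<close>, with the first and the last index as exceptions.\<close>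
  define K where "K j = (if j = 1 then l 0 else if j = 2 * r + 2 then f (l r)
    else if even j then l (j div 2) else f (l ((j - 3) div 2)))" for j
  have KL: "K (psi_left k) = l k" and KR: "K (psi_right r k) = f (l k)" if "k \<le> r" for k
    using that
    by (cases "k = 0"; cases "k = r"; simp add: K_def psi_left_def psi_right_def max_def min_def)+
  have step: "K j < K (Suc j)" if j: "1 \<le> j" "j < 2 * r + 2" for j
  proof -
    have c: "l i < f (l i)" if "i \<le> r" for i
      using chain that by (auto simp: chain_def)
    have c1: "l i < l (Suc i)" "l (Suc i) < f (l i)" "f (l i) < f (l (Suc i))" if "i < r" for i
      using chain that by (auto simp: chain_def)
    have c2: "f (l i) < l (i + 2)" if "i + 2 \<le> r" for i
      using chain that by (auto simp: chain_def)
    consider "j = 1" | t where "j = 2 * t + 2" "t < r" | t where "j = 2 * t + 3" "t < r"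
    proof -
      assume *: "j = 1 \<Longrightarrow> thesis" "\<And>t. j = 2 * t + 2 \<Longrightarrow> t < r \<Longrightarrow> thesis"
        "\<And>t. j = 2 * t + 3 \<Longrightarrow> t < r \<Longrightarrow> thesis"
      have "j = 1 \<or> j = 2 * ((j - 2) div 2) + 2 \<and> (j - 2) div 2 < r
        \<or> j = 2 * ((j - 3) div 2) + 3 \<and> (j - 3) div 2 < r"
        using j by presburger
      then show thesis using * by blast
    qed
    then show ?thesis
    proof cases
      case 1
      then show ?thesis using c[of 0] c1[of 0] by (auto simp: K_def)
    next
      case (2 t)
      then show ?thesis using c1[of t] by (auto simp: K_def)
    next
      case (3 t)
      then show ?thesis using c1[of t] c2[of t]
        by (cases "Suc t = r") (auto simp: K_def)
    qed
  qed
  have mono: "strict_mono_on {1..2 * r + 2} K"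
    by (rule strict_mono_onI) (use bounded_Suc_mono[of 1 "2 * r + 2" K] step in auto)
  have "K ` {1..2 * r + 2} = kernel w"
  proof (intro equalityI subsetI)
    fix x assume "x \<in> K ` {1..2 * r + 2}"
    then obtain j where "j \<in> {1..2 * r + 2}" "x = K j" by blast
    then show "x \<in> kernel w"
      by (cases j r rule: psi_index_cases) (auto simp: ker arcs_def KL KR)
  next
    fix x assume "x \<in> kernel w"
    then obtain k where "k \<le> r" "x = l k \<or> x = f (l k)" by (auto simp: ker arcs_def)
    then have "x = K (psi_left k) \<or> x = K (psi_right r k)" by (simp add: KL KR)
    then show "x \<in> K ` {1..2 * r + 2}"
      using psi_left_in psi_right_in \<open>k \<le> r\<close> by blast
  qed
  moreover have "f (K j) = K (entry (psi r) j)" if "j \<in> {1..2 * r + 2}" for j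
    using that
  proof (cases rule: psi_index_cases)
    case (1 k)
    then show ?thesis by (simp add: KL KR)
  next
    case (2 k)
    then show ?thesis using chain f_f by (simp add: KL KR chain_def)
  qed
  ultimately show ?thesis
    using mono kernel_shape_iff[OF psi_involution] by blast
qed

lemma extremal_kernel_shape:
  assumes "kernel_shape w \<rho>" "capacity \<rho> = r" "length \<rho> = 2 * r + 2"
  shows "\<rho> = psi r"
proof -
  have "card (inside (kernel w)) = r" "card (kernel w) = 2 * r + 2"
    using kernel_shape_measures[OF assms(1)] assms(2,3) by simp_all
  then obtain l where "chain r l" "kernel w = arcs r l"
    by (rule extremal_kernel_chain)
  then show ?thesis using chain_kernel_shape kernel_shape_unique assms(1) by blast
qed

text \<open>\<open>K\<close> lists the kernel entries, and the sentinel \<open>n + 1\<close> closes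
  the last gap; there is no gap before \<open>K 1 = 1\<close>. Existence of such a \<open>K\<close>
  turns out to be equivalent to having kernel shape \<open>psi r\<close> and exactly
  \<open>r\<close> occurrences.\<close>

definition framed :: "nat \<Rightarrow> (nat \<Rightarrow> nat) \<Rightarrow> bool" where
  "framed r K \<longleftrightarrow> strict_mono_on {1..2 * r + 3} K \<and> K 1 = 1 \<and> K (2 * r + 3) = n + 1 \<and>
     (\<forall>i\<in>{1..2 * r + 2}. f (K i) = K (entry (psi r) i)) \<and>
     (\<forall>i\<in>{1..2 * r + 2}. \<forall>x\<in>{K i<..<K (Suc i)}. f x \<in> {K i<..<K (Suc i)}) \<and>
     (\<forall>i\<in>{1..2 * r + 2}. if even i \<and> i \<le> 2 * r
        then \<forall>x\<in>{K i<..<K (Suc i)}. \<forall>y\<in>{K i<..<K (Suc i)}. x < y \<longrightarrow> f y < f x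
        else \<forall>c d a b. {a, b, c, d} \<subseteq> {K i<..<K (Suc i)} \<longrightarrow> \<not> pat c d a b)"

lemma framedD:
  assumes "framed r K"
  shows "strict_mono_on {1..2 * r + 3} K" "K 1 = 1" "K (2 * r + 3) = n + 1"
    "\<And>i. i \<in> {1..2 * r + 2} \<Longrightarrow> f (K i) = K (entry (psi r) i)"
    "\<And>i x. i \<in> {1..2 * r + 2} \<Longrightarrow> x \<in> {K i<..<K (Suc i)} \<Longrightarrow> f x \<in> {K i<..<K (Suc i)}"
    "\<And>i. i \<in> {1..2 * r + 2} \<Longrightarrow> if even i \<and> i \<le> 2 * r
        then \<forall>x\<in>{K i<..<K (Suc i)}. \<forall>y\<in>{K i<..<K (Suc i)}. x < y \<longrightarrow> f y < f x
        else \<forall>c d a b. {a, b, c, d} \<subseteq> {K i<..<K (Suc i)} \<longrightarrow> \<not> pat c d a b"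
  using assms unfolding framed_def by blast+

lemma framedI:
  assumes "strict_mono_on {1..2 * r + 3} K" "K 1 = 1" "K (2 * r + 3) = n + 1"
    and "\<And>i. i \<in> {1..2 * r + 2} \<Longrightarrow> f (K i) = K (entry (psi r) i)"
    and "\<And>i x. i \<in> {1..2 * r + 2} \<Longrightarrow> x \<in> {K i<..<K (Suc i)} \<Longrightarrow> f x \<in> {K i<..<K (Suc i)}"
    and dec: "\<And>i x y. i \<in> {1..2 * r + 2} \<Longrightarrow> even i \<Longrightarrow> i \<le> 2 * r \<Longrightarrow>
        x \<in> {K i<..<K (Suc i)} \<Longrightarrow> y \<in> {K i<..<K (Suc i)} \<Longrightarrow> x < y \<Longrightarrow> f y < f x"
    and avoid: "\<And>i a b c d. i \<in> {1..2 * r + 2} \<Longrightarrow> \<not> (even i \<and> i \<le> 2 * r) \<Longrightarrow>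
        {a, b, c, d} \<subseteq> {K i<..<K (Suc i)} \<Longrightarrow> \<not> pat c d a b"
  shows "framed r K"
proof -
  have "if even i \<and> i \<le> 2 * r
      then \<forall>x\<in>{K i<..<K (Suc i)}. \<forall>y\<in>{K i<..<K (Suc i)}. x < y \<longrightarrow> f y < f x
      else \<forall>c d a b. {a, b, c, d} \<subseteq> {K i<..<K (Suc i)} \<longrightarrow> \<not> pat c d a b"
    if "i \<in> {1..2 * r + 2}" for i
  proof (cases "even i \<and> i \<le> 2 * r")
    case True
    then show ?thesis unfolding if_P[OF True] using dec[OF that] by blast
  next
    case False
    then show ?thesis unfolding if_not_P[OF False] using avoid[OF that False] by blast
  qed
  then show ?thesis unfolding framed_def using assms(1-5) by blast
qed

text \<open>If \<open>a\<close> were in a gap, that gap would contain the crossing arcs of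
  \<open>a\<close> and \<open>b\<close>; if \<open>b\<close> were in a gap, the kernel entry
  \<open>f a\<close> would be in it too. So \<open>a\<close> and \<open>b\<close> start crossing,
  hence consecutive, kernel arcs. Then \<open>c\<close> and \<open>d\<close> are right ends of these
  arcs or lie in the gap under both, which its decreasing order rules out.\<close>

lemma framed_occurrence:
  assumes fr: "framed r K" and p: "pat c d a b" and cross: "b < f a"
  shows "\<exists>k<r. a = K (psi_left k) \<and> b = K (psi_left (Suc k)) \<and>
    c = K (psi_right r k) \<and> d = K (psi_right r (Suc k))"
proof -
  let ?I = "{1..2 * r + 2}"
  let ?G = "\<lambda>i. {K i<..<K (Suc i)}"
  have mono: "K i < K j \<longleftrightarrow> i < j" if "i \<in> {1..2 * r + 3}" "j \<in> {1..2 * r + 3}" for i j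
    using fr that strict_mono_on_less[of "{1..2 * r + 3}" K] by (simp add: framed_def)
  have K: "K 1 = 1" "K (Suc (2 * r + 2)) = n + 1" "\<And>i. i \<in> ?I \<Longrightarrow> f (K i) = K (entry (psi r) i)"
    "\<And>i x. i \<in> ?I \<Longrightarrow> x \<in> ?G i \<Longrightarrow> f x \<in> ?G i"
    using framedD[OF fr] by (simp_all add: eval_nat_numeral)
  have dec_gap: "f y < f x"
    if "i \<in> ?I" "even i" "i \<le> 2 * r" "x \<in> ?G i" "y \<in> ?G i" "x < y" for i x y
    using framedD(6)[OF fr that(1)] that(2-) by simp
  have ord: "a < b" "b < c" "c < d" "f c < f d" "f d < f a" "f a < f b"
    and dom: "a \<in> {1..n}" "b \<in> {1..n}" "c \<in> {1..n}" "d \<in> {1..n}"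
    using p by (auto simp: pat_def)
  have no_pat: "\<not> pat c d a b" if "i \<in> ?I" "{a, b, c, d} \<subseteq> ?G i" for i a b c d
  proof (cases "even i \<and> i \<le> 2 * r")
    case True
    then show ?thesis using dec_gap[of i c d] that by (auto simp: pat_def)
  next
    case False
    then show ?thesis using framedD(6)[OF fr that(1)] that(2) unfolding if_not_P[OF False] by blast
  qed
  have cases: "\<exists>i\<in>?I. x = K i \<or> x \<in> ?G i" if "x \<in> {1..n}" for x
  proof -
    have "K 1 \<le> x" "x < K (Suc (2 * r + 2))" using that K(1,2) by auto
    then obtain i where "i \<in> ?I" "K i \<le> x" "x < K (Suc i)" using interval_exists by blast
    then show ?thesis by (intro bexI[of _ i]) auto
  qed
  obtain i where i: "i \<in> ?I" "a = K i"
  proof -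
    obtain i where i: "i \<in> ?I" "a = K i \<or> a \<in> ?G i" using cases dom by blast
    have "a \<notin> ?G i"
    proof
      assume a: "a \<in> ?G i"
      have fa: "f a \<in> ?G i" using K(4) i(1) a by blast
      have b: "b \<in> ?G i" using a fa ord cross by auto
      have fb: "f b \<in> ?G i" using K(4) i(1) b by blast
      show False
        using no_pat[OF i(1), of a b "f a" "f b"] a fa b fb pat_crossing dom ord cross by simp
    qed
    then show ?thesis using that i by blast
  qed
  obtain j where j: "j \<in> ?I" "b = K j"
  proof -
    obtain j where j: "j \<in> ?I" "b = K j \<or> b \<in> ?G j" using cases dom by blast
    have "b \<notin> ?G j"
    proof
      assume b: "b \<in> ?G j"
      then have "f b \<in> ?G j" using K(4) j(1) by blast
      then have "K j < K (entry (psi r) i)" "K (entry (psi r) i) < K (Suc j)"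
        using b cross ord K(3) i by auto
      then show False
        using mono[of j "entry (psi r) i"] mono[of "entry (psi r) i" "Suc j"] psi_entry_in[OF i(1)] j(1) by simp
    qed
    then show ?thesis using that j by blast
  qed
  have fK: "f a = K (entry (psi r) i)" "f b = K (entry (psi r) j)" using K(3) i j by auto
  have "i < j" "j < entry (psi r) i" "entry (psi r) i < entry (psi r) j"
    using ord cross i j fK mono psi_entry_in[OF i(1)] psi_entry_in[OF j(1)] by auto
  then obtain k where k: "k < r" "i = psi_left k" "j = psi_left (Suc k)"
    using psi_crossing i j by blast
  then have eij: "entry (psi r) i = psi_right r k" "entry (psi r) j = psi_right r (Suc k)"
    using entry_psi_left by auto
  have right: "psi_right r k = 2 * k + 3" and left: "psi_left (Suc k) = 2 * k + 2"
    using k by (auto simp: psi_left_def psi_right_def)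
  have up: "x = K (psi_right r k) \<or> x = K (psi_right r (Suc k)) \<or> x \<in> ?G (2 * k + 2)"
    if x: "x \<in> {1..n}" "b < x" "f x < f a" for x
  proof -
    obtain h where h: "h \<in> ?I" "x = K h \<or> x \<in> ?G h" using cases x by blast
    show ?thesis
    proof (cases "x = K h")
      case True
      then have "2 * k + 2 < h" "entry (psi r) h < 2 * k + 3"
        using x h j k left right mono[of "2 * k + 2" h] mono[of "entry (psi r) h" "2 * k + 3"]
          psi_entry_in[OF h(1)] K(3) fK eij by auto
      then show ?thesis using psi_double_gap[OF h(1) k(1)] True by auto
    next
      case False
      then have xG: "x \<in> ?G h" using h by blast
      then have "f x \<in> ?G h" using K(4) h(1) by blast
      then have "K h < K (2 * k + 3)" "K (2 * k + 2) < K (Suc h)"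
        using xG x fK eij right left j k by auto
      then have "h = 2 * k + 2" using mono[of h "2 * k + 3"] mono[of "2 * k + 2" "Suc h"] h(1) k(1) by simp
      then show ?thesis using xG by blast
    qed
  qed
  have gap_in: "2 * k + 2 \<in> ?I" using k by simp
  have dec: "f y < f x" if "x \<in> ?G (2 * k + 2)" "y \<in> ?G (2 * k + 2)" "x < y" for x y
    using dec_gap[OF gap_in _ _ that] k(1) by simp
  have frights: "f (K (psi_right r k)) = K (psi_left k)" "f (K (psi_right r (Suc k))) = K (psi_left (Suc k))"
    using K(3) psi_right_in entry_psi_right k by auto
  have "psi_right r k < psi_right r (Suc k)" using k by (auto simp: psi_right_def)
  then have Krights: "K (psi_right r k) < K (psi_right r (Suc k))"
    using mono psi_right_in[of k r] psi_right_in[of "Suc k" r] k by auto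
  have gap_less: "x < K (psi_right r k)" if "x \<in> ?G (2 * k + 2)" for x
    using that right by (simp add: eval_nat_numeral)
  have "c = K (psi_right r k) \<and> d = K (psi_right r (Suc k))"
  proof -
    have c: "c = K (psi_right r k) \<or> c = K (psi_right r (Suc k)) \<or> c \<in> ?G (2 * k + 2)"
      using up[of c] dom ord by auto
    have d: "d = K (psi_right r k) \<or> d = K (psi_right r (Suc k)) \<or> d \<in> ?G (2 * k + 2)"
      using up[of d] dom ord by auto
    \<comment> \<open>The entries at the two right ends stand at positions up to
      \<open>K (2 * k + 2)\<close>, before the gap. So with \<open>c\<close> also \<open>d\<close>
      would be in the gap, where \<open>f\<close> is decreasing.\<close>
    have "c \<notin> ?G (2 * k + 2)"
    proof
      assume cG: "c \<in> ?G (2 * k + 2)"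
      then have "K (2 * k + 2) < f c" using K(4)[OF gap_in] by fastforce
      moreover have "K (psi_left k) < K (psi_left (Suc k))" using i j ord k by simp
      ultimately have "d \<in> ?G (2 * k + 2)" using d ord frights left by auto
      then show False using dec[of c d] cG ord by simp
    qed
    then show ?thesis using c d ord Krights gap_less[of d] by auto
  qed
  then show ?thesis using i j k by auto
qed

text \<open>An occurrence of the other kind is the reflection of one found in
  \<open>framed_occurrence\<close>, and those are their own reflections.\<close>

lemma framed_occurrences:
  assumes fr: "framed r K"
  defines "occ \<equiv> \<lambda>k. [K (psi_right r k), K (psi_right r (Suc k)), K (psi_left k), K (psi_left (Suc k))]"
  shows "occurrences w = occ ` {..<r}" and "card (occurrences w) = r"
proof -
  have mono: "K i < K j" if "i < j" "i \<in> {1..2 * r + 3}" "j \<in> {1..2 * r + 3}" for i j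
    using fr that strict_mono_onD[of "{1..2 * r + 3}" K i j] by (simp add: framed_def)
  have fK: "f (K i) = K (entry (psi r) i)" if "i \<in> {1..2 * r + 2}" for i
    using fr that by (simp add: framed_def)
  have in_n: "K i \<in> {1..n}" if "i \<in> {1..2 * r + 2}" for i
  proof -
    have "K 1 \<le> K i" using mono[of 1 i] that by (cases "i = 1") auto
    moreover have "K i < K (2 * r + 3)" using mono[of i "2 * r + 3"] that by simp
    ultimately show ?thesis using fr by (simp add: framed_def)
  qed
  have fL: "f (K (psi_left k)) = K (psi_right r k)" and fR: "f (K (psi_right r k)) = K (psi_left k)"
    if "k \<le> r" for k
    using that fK psi_left_in psi_right_in entry_psi_left entry_psi_right by auto
  have sub: "[c, d, a, b] \<in> occ ` {..<r}" if p: "pat c d a b" for c d a b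
    using p
  proof (cases rule: pat_crossing_cases)
    case 1
    then show ?thesis using framed_occurrence[OF fr p] by (auto simp: occ_def)
  next
    case 2
    have dom: "a \<in> {1..n}" "b \<in> {1..n}" "c \<in> {1..n}" "d \<in> {1..n}"
      using p by (auto simp: pat_def)
    then obtain k where k: "k < r" "f c = K (psi_left k)" "f d = K (psi_left (Suc k))"
      "f a = K (psi_right r k)" "f b = K (psi_right r (Suc k))"
      using framed_occurrence[OF fr pat_mirror[OF p]] 2 f_f by auto
    then have "c = K (psi_right r k)" "d = K (psi_right r (Suc k))"
      "a = K (psi_left k)" "b = K (psi_left (Suc k))"
      using f_f dom fL fR by (metis Suc_leI less_imp_le)+
    then show ?thesis using k(1) by (auto simp: occ_def)
  qed
  have sup: "occ k \<in> occurrences w" if k: "k < r" for k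
  proof -
    have "pat (f (K (psi_left k))) (f (K (psi_left (Suc k)))) (K (psi_left k)) (K (psi_left (Suc k)))"
    proof (rule pat_crossing)
      have "psi_left k < psi_left (Suc k)" "psi_left (Suc k) < psi_right r k"
        "psi_right r k < psi_right r (Suc k)"
        using k by (auto simp: psi_left_def psi_right_def)
      moreover have "{psi_left k, psi_left (Suc k), psi_right r k, psi_right r (Suc k)} \<subseteq> {1..2 * r + 3}"
        using psi_left_in[of k r] psi_left_in[of "Suc k" r] psi_right_in[of k r] psi_right_in[of "Suc k" r] k
        by auto
      ultimately show "K (psi_left k) < K (psi_left (Suc k))" "K (psi_left (Suc k)) < f (K (psi_left k))"
        "f (K (psi_left k)) < f (K (psi_left (Suc k)))"
        using mono k fL[of k] fL[of "Suc k"] by simp_all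
    qed (use in_n psi_left_in k in \<open>simp_all del: atLeastAtMost_iff\<close>)
    then show ?thesis using k by (simp add: occ_def in_occurrences_iff fL)
  qed
  show eq: "occurrences w = occ ` {..<r}"
    using sub sup occurrences_eq by auto
  have "inj_on occ {..<r}"
  proof (rule inj_onI)
    fix k k' assume kk: "k \<in> {..<r}" "k' \<in> {..<r}" "occ k = occ k'"
    have "K (psi_left (Suc k)) < K (psi_left (Suc k'))" if "k < k'" "k' < r" for k k'
      using that by (intro mono) (auto simp: psi_left_def)
    moreover have "K (psi_left (Suc k)) = K (psi_left (Suc k'))" using kk by (simp add: occ_def)
    ultimately show "k = k'" using kk by (metis lessThan_iff linorder_neqE_nat order.irrefl)
  qed
  then show "card (occurrences w) = r" by (simp add: eq card_image)
qed

text \<open>All occurrences lie in the image of \<open>K\<close>, so minimality bounds the kernel.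
  Conversely, the occurrence of the arcs \<open>k\<close> and \<open>k + 1\<close> passes membership
  from one arc to the next.\<close>

lemma framed_kernel:
  assumes fr: "framed r K"
  shows "kernel w = K ` {1..2 * r + 2}"
proof
  have K1: "K 1 = 1" by (rule framedD(2)[OF fr])
  have f1: "f 1 = K (entry (psi r) 1)"
    using framedD(4)[OF fr, of 1] unfolding K1 by simp
  show "kernel w \<subseteq> K ` {1..2 * r + 2}"
  proof (rule kernel_least)
    show "1 \<in> K ` {1..2 * r + 2}" 
      using imageI[of 1 "{1..2 * r + 2}" K] unfolding K1 by simp
    show "f 1 \<in> K ` {1..2 * r + 2}"
      unfolding f1 by (rule imageI) (rule psi_entry_in, simp)
    fix s assume "s \<in> occurrences w"
    then obtain k where "k < r"
      "s = [K (psi_right r k), K (psi_right r (Suc k)), K (psi_left k), K (psi_left (Suc k))]"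
      using framed_occurrences(1)[OF fr] by blast
    then show "set s \<subseteq> K ` {1..2 * r + 2}"
      using psi_left_in[of k r] psi_right_in[of k r] psi_left_in[of "Suc k" r] psi_right_in[of "Suc k" r]
      by (auto simp del: atLeastAtMost_iff)
  qed
  have "K (psi_left k) \<in> kernel w \<and> K (psi_right r k) \<in> kernel w" if "k \<le> r" for k
    using that
  proof (induction k)
    case 0
    have "psi_left 0 = 1" by (simp add: psi_left_def)
    then show ?case
      using one_in_kernel f_one_in_kernel f1 K1 entry_psi_left[of 0 r] by simp
  next
    case (Suc k)
    let ?s = "[K (psi_right r k), K (psi_right r (Suc k)), K (psi_left k), K (psi_left (Suc k))]"
    have "?s \<in> occurrences w"
      using framed_occurrences(1)[OF fr] Suc.prems by simp
    then show ?case using kernel_closed[of ?s] Suc by simp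
  qed
  then show "K ` {1..2 * r + 2} \<subseteq> kernel w"
    by (intro image_subsetI) (erule psi_index_cases; simp)
qed

lemma framed_kernel_shape:
  assumes fr: "framed r K"
  shows "kernel_shape w (psi r)" "capacity w = r"
proof -
  have "strict_mono_on {1..2 * r + 2} K"
    using fr monotone_on_subset[of "{1..2 * r + 3}" "(<)" "(<)" K "{1..2 * r + 2}"]
    by (auto simp: framed_def)
  then show "kernel_shape w (psi r)"
    using fr framed_kernel[OF fr] unfolding kernel_shape_iff[OF psi_involution] framed_def by metis
  show "capacity w = r" using framed_occurrences(2)[OF fr] by (simp add: capacity_def)
qed

end

text \<open>All gaps are empty, so \<open>psi r\<close> is a framed word, and its capacity and
  kernel shape come from the general result.\<close>

lemma psi_framed: "nonempty_involution_word.framed (psi r) (2 * r + 2) r (\<lambda>i. i)"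
  and psi_word: "nonempty_involution_word (psi r) (2 * r + 2)"
proof -
  show "nonempty_involution_word (psi r) (2 * r + 2)"
    by unfold_locales (rule psi_involution, simp)
  then interpret nonempty_involution_word "psi r" "2 * r + 2" .
  have "{i<..<Suc i} = {}" for i by auto
  then show "framed r (\<lambda>i. i)" unfolding framed_def by (simp add: strict_mono_on_def)
qed

lemma capacity_psi: "capacity (psi r) = r" and kernel_shape_psi: "kernel_shape (psi r) (psi r)"
  using nonempty_involution_word.framed_kernel_shape[OF psi_word psi_framed] by auto

context nonempty_involution_word
begin

text \<open>The kernel already contains \<open>r\<close> occurrences, so every occurrence consists
  of kernel entries; each violated condition would produce one with an entry in a gap.\<close>

lemma framed_of_kernel_shape:
  assumes shape: "kernel_shape w (psi r)" and cap: "capacity w = r"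
  shows "\<exists>K. framed r K"
proof -
  let ?I = "{1..2 * r + 2}"
  obtain K0 where K0: "strict_mono_on ?I K0" "K0 ` ?I = kernel w"
    "\<forall>i\<in>?I. f (K0 i) = K0 (entry (psi r) i)"
    using shape kernel_shape_iff[OF psi_involution] by blast
  define K where "K = K0(2 * r + 3 := n + 1)"
  let ?G = "\<lambda>i. {K i<..<K (Suc i)}"
  have K_K0: "K i = K0 i" if "i \<in> ?I" for i using that by (simp add: K_def)
  have K_last: "K (2 * r + 3) = n + 1" by (simp add: K_def)
  have im: "kernel w = K ` ?I"
    unfolding K0(2)[symmetric] by (rule image_cong) (simp_all only: K_K0)
  have K_ker: "K i \<in> kernel w" if "i \<in> ?I" for i using that im by blast
  have mono: "strict_mono_on {1..2 * r + 3} K"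
  proof (rule strict_mono_onI)
    fix i j assume ij: "i \<in> {1..2 * r + 3}" "j \<in> {1..2 * r + 3}" "i < j"
    then have i: "i \<in> ?I" by simp
    show "K i < K j"
    proof (cases "j = 2 * r + 3")
      case True
      then show ?thesis using K_ker[OF i] kernel_subset K_last by fastforce
    next
      case False
      then have "j \<in> ?I" using ij by simp
      then show ?thesis using strict_mono_onD[OF K0(1)] i ij K_K0 by simp
    qed
  qed
  have less: "K i < K j \<longleftrightarrow> i < j" if "i \<in> {1..2 * r + 3}" "j \<in> {1..2 * r + 3}" for i j
    using strict_mono_on_less[OF mono] that by simp
  have K1: "K 1 = 1"
  proof -
    obtain i where "i \<in> ?I" "1 = K i" using one_in_kernel unfolding im by blast
    moreover have "1 \<le> K 1" using K_ker[of 1] kernel_subset by force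
    moreover have "K 1 \<le> K i" using strict_mono_on_leD[OF mono, of 1 i] \<open>i \<in> ?I\<close> by simp
    ultimately show ?thesis by simp
  qed
  have fK: "f (K i) = K (entry (psi r) i)" if "i \<in> ?I" for i
    using K0(3) K_K0 psi_entry_in that by simp
  have "inside (kernel w) = occurrences w"
  proof (rule card_subset_eq[OF finite_occurrences])
    show "card (inside (kernel w)) = card (occurrences w)"
      using kernel_shape_measures(2)[OF shape] cap unfolding capacity_psi capacity_def[of w] by simp
  qed (auto simp: inside_def)
  then have all_in: "set s \<subseteq> kernel w" if "s \<in> occurrences w" for s
    using that by (auto simp: inside_def)
  have gap_not_ker: "x \<notin> kernel w" if "i \<in> ?I" "x \<in> ?G i" for i x
  proof
    assume "x \<in> kernel w"
    then obtain j where "j \<in> ?I" "x = K j" unfolding im by blast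
    then show False using that less[of i j] less[of j "Suc i"] by auto
  qed
  have gap_in: "x \<in> {1..n}" if "i \<in> ?I" "x \<in> ?G i" for i x
  proof -
    have "K i \<in> {1..n}" using K_ker that(1) kernel_subset by blast
    moreover have "K (Suc i) \<le> n + 1"
      using strict_mono_on_leD[OF mono, of "Suc i" "2 * r + 3"] that(1) K_last by simp
    ultimately show ?thesis using that(2) by auto
  qed
  have cover: "K p < x \<and> x < K q \<longleftrightarrow> p \<le> i \<and> i < q"
    if "i \<in> ?I" "x \<in> ?G i" "p \<in> ?I" "q \<in> ?I" for i x p q
  proof -
    have "K p < x \<longleftrightarrow> p \<le> i"
      using that less[of i p] strict_mono_on_leD[OF mono, of p i]
        strict_mono_on_leD[OF mono, of "Suc i" p] by fastforce
    moreover have "x < K q \<longleftrightarrow> i < q"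
      using that strict_mono_on_leD[OF mono, of q i]
        strict_mono_on_leD[OF mono, of "Suc i" q] by fastforce
    ultimately show ?thesis by simp
  qed
  have stable: "f x \<in> ?G i" if x: "i \<in> ?I" "x \<in> ?G i" for i x
  proof (rule ccontr)
    assume out: "f x \<notin> ?G i"
    have fx_ker: "f x \<notin> kernel w"
      using kernel_f[of "f x"] f_f[OF gap_in[OF x]] gap_not_ker[OF x] by auto
    obtain j where j: "j \<in> ?I" "K j \<le> f x" "f x < K (Suc j)"
    proof -
      have "K 1 \<le> f x" "f x < K (Suc (2 * r + 2))"
        using f_in[OF gap_in[OF x]] K1 K_last by (simp_all add: eval_nat_numeral)
      then show ?thesis using interval_exists that by blast
    qed
    then have jG: "f x \<in> ?G j" using K_ker[OF j(1)] fx_ker by (cases "K j = f x") auto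
    then have "i \<noteq> j" using out by blast
    \<comment> \<open>This kernel arc covers exactly one of \<open>x\<close> and \<open>f x\<close>,
      so it crosses their arc.\<close>
    then obtain k where k: "k \<le> r"
      "(psi_left k \<le> i \<and> i < psi_right r k) \<noteq> (psi_left k \<le> j \<and> j < psi_right r k)"
      using psi_separates[OF x(1) j(1)] psi_separates[OF j(1) x(1)] by (metis linorder_neqE_nat)
    let ?p = "K (psi_left k)"
    have fp: "f ?p = K (psi_right r k)" using fK psi_left_in entry_psi_left k(1) by simp
    have "(?p < x \<and> x < f ?p) \<noteq> (?p < f x \<and> f x < f ?p)"
      using cover[OF x] cover[OF j(1) jG] psi_left_in psi_right_in k fp by simp
    moreover have "x \<noteq> ?p" "x \<noteq> f ?p" "f x \<noteq> ?p" "f x \<noteq> f ?p"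
      using gap_not_ker[OF x] fx_ker K_ker[OF psi_left_in[OF k(1)]] K_ker[OF psi_right_in[OF k(1)]] fp
      by auto
    moreover have "?p < f ?p"
      unfolding fp using less psi_left_in[OF k(1)] psi_right_in[OF k(1)] k(1)
      by (auto simp: psi_left_def psi_right_def)
    ultimately have "arcs_cross x (f x) ?p (f ?p)"
      by (auto simp: arcs_cross_def min_def max_def)
    moreover have "?p \<in> {1..n}" using K_ker[OF psi_left_in[OF k(1)]] kernel_subset by blast
    ultimately obtain s where "s \<in> occurrences w" "x \<in> set s"
      using occurrence_of_crossing gap_in[OF x] by force
    then show False using all_in gap_not_ker[OF x] by blast
  qed
  have dec: "f y < f x" if i: "i \<in> ?I" "even i" "i \<le> 2 * r" and xy: "x \<in> ?G i" "y \<in> ?G i" "x < y" for i x y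
  proof (rule ccontr)
    assume "\<not> f y < f x"
    then have fxy: "f x < f y"
      using f_eq_iff[OF gap_in[OF i(1) xy(1)] gap_in[OF i(1) xy(2)]] xy(3) by linarith
    obtain k where k: "i = 2 * k + 2" "k < r"
    proof -
      from i(2) obtain h where "i = 2 * h" by (rule evenE)
      then show ?thesis using that[of "h - 1"] i by auto
    qed
    have lr: "psi_left (Suc k) = i" "psi_right r k = Suc i" using k by (auto simp: psi_left_def psi_right_def)
    have fL: "f (K (psi_left h)) = K (psi_right r h)" if "h \<le> r" for h
      using fK[OF psi_left_in[OF that]] entry_psi_left[OF that] by simp
    have fl: "f (K (psi_left k)) = K (Suc i)" "f (K (psi_left (Suc k))) = K (psi_right r (Suc k))"
      using fL[of k] fL[of "Suc k"] k(2) lr by simp_all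
    have "K (psi_left k) < K (psi_left (Suc k))" "K (Suc i) < K (psi_right r (Suc k))"
      using less[of "psi_left k" "psi_left (Suc k)"] less[of "Suc i" "psi_right r (Suc k)"] k
      by (auto simp: psi_left_def psi_right_def)
    moreover have "K (psi_left k) \<in> {1..n}" "K (psi_left (Suc k)) \<in> {1..n}"
      using K_ker psi_left_in[of k r] psi_left_in[of "Suc k" r] k kernel_subset by (auto simp del: atLeastAtMost_iff)
    moreover have "f (f x) = x" "f (f y) = y" "f x \<in> {1..n}" "f y \<in> {1..n}"
      using f_f f_in gap_in i(1) xy by auto
    \<comment> \<open>The entries \<open>f x\<close> and \<open>f y\<close> stand inside the gap at
      \<open>x < y\<close>. The two left ends are smaller entries and stand at the right ends of
      their arcs, behind the gap.\<close>
    ultimately have "pat (f x) (f y) (K (psi_left k)) (K (psi_left (Suc k)))"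
      using stable[OF i(1) xy(1)] fxy xy lr fl by (simp add: pat_def)
    then have "[f x, f y, K (psi_left k), K (psi_left (Suc k))] \<in> occurrences w"
      by (simp add: in_occurrences_iff)
    from all_in[OF this] show False using gap_not_ker[OF i(1) stable[OF i(1) xy(1)]] by simp
  qed
  have no_pat: "\<not> pat c d a b" if "i \<in> ?I" "\<not> (even i \<and> i \<le> 2 * r)" "{a, b, c, d} \<subseteq> ?G i" for i a b c d
    using all_in[of "[c, d, a, b]"] gap_not_ker[of i a] that by (auto simp: in_occurrences_iff)
  have "framed r K"
    by (rule framedI[OF mono K1 K_last fK stable dec no_pat])
  then show ?thesis by blast
qed

end

section \<open>Generating functions\<close>

definition length_gf :: "nat list set \<Rightarrow> rat fps" where
  "length_gf A = Abs_fps (\<lambda>n. of_nat (card {u \<in> A. length u = n}))"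

text \<open>Independent choices multiply generating functions. Finiteness is proved along with the
  count, as the cardinality of the disjoint union in the induction step depends on it.\<close>

lemma PiE_length_gf:
  assumes "finite I" "\<And>i n. i \<in> I \<Longrightarrow> finite {u \<in> A i. length u = n}"
  shows "finite {g \<in> PiE I A. (\<Sum>i\<in>I. length (g i)) = n} \<and>
    of_nat (card {g \<in> PiE I A. (\<Sum>i\<in>I. length (g i)) = n}) = fps_nth (\<Prod>i\<in>I. length_gf (A i)) n"
  using assms
proof (induction I arbitrary: n rule: finite_induct)
  case empty
  show ?case by (cases "n = 0") (simp_all add: PiE_empty_domain)
next
  case (insert x I)
  let ?G = "\<lambda>n. {g \<in> PiE I A. (\<Sum>i\<in>I. length (g i)) = n}"
  let ?B = "\<lambda>k. {u \<in> A x. length u = k} \<times> ?G (n - k)"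
  let ?h = "\<lambda>(y, g). g(x := y)"
  have IH: "finite (?G k)" "of_nat (card (?G k)) = fps_nth (\<Prod>i\<in>I. length_gf (A i)) k" for k
    using insert.IH[of k] insert.prems by auto
  have fin: "finite (?B k)" for k using IH insert.prems by simp
  have sum_upd: "(\<Sum>i\<in>I. length ((g(x := y)) i)) = (\<Sum>i\<in>I. length (g i))" for g y
    by (rule sum.cong) (use insert.hyps in auto)
  \<comment> \<open>A family splits into its value at \<open>x\<close>, of some length
    \<open>k\<close>, and a family on \<open>I\<close> of total length \<open>n - k\<close>.\<close>
  have eq: "{g \<in> PiE (insert x I) A. (\<Sum>i\<in>insert x I. length (g i)) = n} = ?h ` (\<Union>k\<le>n. ?B k)"
  proof (intro equalityI subsetI)
    fix g assume "g \<in> {g \<in> PiE (insert x I) A. (\<Sum>i\<in>insert x I. length (g i)) = n}"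
    then have g: "g \<in> PiE (insert x I) A" "(\<Sum>i\<in>insert x I. length (g i)) = n" by auto
    from g(1) obtain y g' where yg: "y \<in> A x" "g' \<in> PiE I A" "g = g'(x := y)"
      unfolding PiE_insert_eq by auto
    have "length y + (\<Sum>i\<in>I. length (g' i)) = n"
      using g(2) insert.hyps yg(3) sum_upd[of g' y] by simp
    then show "g \<in> ?h ` (\<Union>k\<le>n. ?B k)"
      using yg by (intro image_eqI[of _ _ "(y, g')"]) auto
  next
    fix g assume "g \<in> ?h ` (\<Union>k\<le>n. ?B k)"
    then obtain k y g' where "k \<le> n" "y \<in> A x" "length y = k" "g' \<in> PiE I A"
      "(\<Sum>i\<in>I. length (g' i)) = n - k" "g = g'(x := y)" by auto
    then show "g \<in> {g \<in> PiE (insert x I) A. (\<Sum>i\<in>insert x I. length (g i)) = n}"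
      using insert.hyps sum_upd[of g' y] unfolding PiE_insert_eq by force
  qed
  have "inj_on ?h (\<Union>k\<le>n. ?B k)"
    by (rule inj_on_subset[OF inj_combinator[OF insert.hyps(2), of A]]) auto
  then have "card (?h ` (\<Union>k\<le>n. ?B k)) = card (\<Union>k\<le>n. ?B k)"
    by (rule card_image)
  also have "\<dots> = (\<Sum>k\<le>n. card (?B k))"
    using fin by (intro card_UN_disjoint) auto
  also have "of_nat \<dots> = (\<Sum>k\<le>n. fps_nth (length_gf (A x)) k * fps_nth (\<Prod>i\<in>I. length_gf (A i)) (n - k))"
    by (simp add: card_cartesian_product IH length_gf_def)
  also have "\<dots> = fps_nth (\<Prod>i\<in>insert x I. length_gf (A i)) n"
    using insert.hyps by (simp add: fps_mult_nth atMost_atLeast0)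
  finally show ?case using fin unfolding eq by simp
qed

text \<open>The gap behind the \<open>i\<close>-th kernel entry is covered by two kernel arcs iff \<open>i\<close> is even and
  \<open>i \<le> 2 r\<close>.\<close>

definition filler :: "nat \<Rightarrow> nat \<Rightarrow> nat list set" where
  "filler r i = (if even i \<and> i \<le> 2 * r then range (\<lambda>k. rev [1..<k + 1])
     else {u. u \<in> involutions (length u) \<and> capacity u = 0})"

lemma entry_rev_upt:
  assumes "t \<in> {1..k}"
  shows "entry (rev [1..<k + 1]) t = k + 1 - t"
proof -
  have "t - 1 < length [1..<k + 1]" "k - t < k" using assms by auto
  then show ?thesis
    using assms unfolding entry_def by (subst rev_nth) (auto simp: nth_append simp del: upt.simps)
qed

lemma rev_upt_involution: "rev [1..<k + 1] \<in> involutions k"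
proof (rule involutionsI)
  fix t assume t: "t \<in> {1..k}"
  then have t': "k + 1 - t \<in> {1..k}" "k + 1 - (k + 1 - t) = t" by auto
  show "entry (rev [1..<k + 1]) t \<in> {1..k} \<and> entry (rev [1..<k + 1]) (entry (rev [1..<k + 1]) t) = t"
    unfolding entry_rev_upt[OF t] entry_rev_upt[OF t'(1)] using t' by simp
qed (simp del: upt.simps)

lemma filler_involution: "u \<in> filler r i \<Longrightarrow> u \<in> involutions (length u)"
  using rev_upt_involution by (auto simp: filler_def simp del: upt.simps split: if_splits)

lemma length_involution: "u \<in> involutions k \<Longrightarrow> length u = k"
  using involution_word.length_w involution_word.intro by blast

lemma length_gf_filler:
  "length_gf (filler r i) = (if even i \<and> i \<le> 2 * r then inverse (1 - fps_X) else I_gf 0)"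
proof (cases "even i \<and> i \<le> 2 * r")
  case True
  have "{u \<in> filler r i. length u = k} = {rev [1..<k + 1]}" for k
    using True by (auto simp: filler_def simp del: upt.simps)
  then have "length_gf (filler r i) = Abs_fps (\<lambda>_. 1)" by (simp add: length_gf_def)
  also have "\<dots> = inverse (1 - fps_X)"
    by (rule fps_inverse_one_minus_fps_X[symmetric])
  finally show ?thesis using True by simp
next
  case False
  have "{u \<in> filler r i. length u = k} = {w \<in> involutions k. capacity w = 0}" for k
    unfolding filler_def if_not_P[OF False] using length_involution by auto
  then show ?thesis unfolding if_not_P[OF False] length_gf_def I_gf_def by simp
qed

lemma finite_filler: "finite {u \<in> filler r i. length u = k}"
proof (rule finite_subset)
  show "{u \<in> filler r i. length u = k} \<subseteq> {u. set u \<subseteq> {1..k} \<and> length u = k}"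
    using filler_involution involution_word.set_w involution_word.intro by blast
qed (simp add: finite_lists_length_eq)

lemma prod_length_gf_filler:
  "(\<Prod>i\<in>{1..2 * r + 2}. length_gf (filler r i)) = inverse (1 - fps_X) ^ r * I_gf 0 ^ (r + 2)"
proof -
  let ?I = "{1..2 * r + 2}" and ?P = "\<lambda>i. even i \<and> i \<le> 2 * r"
  have "?I \<inter> Collect ?P = (\<lambda>k. 2 * k) ` {1..r}" by (auto elim!: evenE)
  moreover have "inj_on (\<lambda>k::nat. 2 * k) {1..r}" by (simp add: inj_on_def)
  ultimately have 1: "card (?I \<inter> Collect ?P) = r" by (simp only: card_image) simp
  have "card ?I = card (?I \<inter> Collect ?P) + card (?I \<inter> - Collect ?P)"
    by (subst card_Un_disjoint[symmetric]) (auto simp: Int_Un_distrib[symmetric])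
  then have 2: "card (?I \<inter> - Collect ?P) = r + 2" using 1 by simp
  show ?thesis
    by (simp only: length_gf_filler prod.If_cases[OF finite_atLeastAtMost] prod_constant 1 2)
qed

section \<open>Assembling an involution from the words in its gaps\<close>

definition knot :: "(nat \<Rightarrow> nat list) \<Rightarrow> nat \<Rightarrow> nat" where
  "knot u i = i + (\<Sum>j\<in>{1..<i}. length (u j))"

lemma knot_1: "knot u 1 = 1"
  by (simp add: knot_def)

lemma knot_Suc: "1 \<le> i \<Longrightarrow> knot u (Suc i) = knot u i + length (u i) + 1"
  by (simp add: knot_def)

lemma knot_last: "knot u (2 * r + 3) = 2 * r + 3 + (\<Sum>i\<in>{1..2 * r + 2}. length (u i))"
proof -
  have "{1..<2 * r + 3} = {1..2 * r + 2}" by auto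
  then show ?thesis by (simp only: knot_def)
qed

lemma knot_mono: "strict_mono_on {1..m} (knot u)"
proof (rule strict_mono_onI)
  fix i j assume ij: "i \<in> {1..m}" "j \<in> {1..m}" "i < j"
  show "knot u i < knot u j"
    by (rule bounded_Suc_mono[of 1 m]) (use ij in \<open>simp_all add: knot_Suc\<close>)
qed

text \<open>\<open>knot u i\<close> is the place of the \<open>i\<close>-th kernel entry when gap
  \<open>j\<close> holds \<open>u j\<close>. The word is prescribed entry by entry: by
  \<open>psi r\<close> at the knots, by shifted gap words between them. Both directions of the
  bijection use only this prescription.\<close>

definition fits :: "nat \<Rightarrow> (nat \<Rightarrow> nat list) \<Rightarrow> nat list \<Rightarrow> bool" where
  "fits r u w \<longleftrightarrow> length w + 1 = knot u (2 * r + 3) \<and>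
     (\<forall>i\<in>{1..2 * r + 2}. entry w (knot u i) = knot u (entry (psi r) i) \<and>
        (\<forall>t\<in>{1..length (u i)}. entry w (knot u i + t) = knot u i + entry (u i) t))"

lemma knot_position:
  assumes "x \<in> {1..<knot u (2 * r + 3)}"
  obtains i t where "i \<in> {1..2 * r + 2}" "t \<le> length (u i)" "x = knot u i + t"
proof -
  have "knot u 1 \<le> x" "x < knot u (Suc (2 * r + 2))"
    using assms unfolding knot_1 by (simp_all add: eval_nat_numeral)
  then obtain i where "i \<in> {1..2 * r + 2}" "knot u i \<le> x" "x < knot u (Suc i)"
    using interval_exists by blast
  then show ?thesis using that[of i "x - knot u i"] by (simp add: knot_Suc)
qed

lemma fits_exists: "\<exists>w. fits r u w"
proof -
  let ?I = "{1..2 * r + 2}"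
  \<comment> \<open>The index of the gap containing \<open>x\<close>, the knot in front counted with
    it; it is unique since the knots increase.\<close>
  define idx where "idx x = (THE i. i \<in> ?I \<and> knot u i \<le> x \<and> x < knot u (Suc i))" for x
  define g where "g x = (if x = knot u (idx x) then knot u (entry (psi r) (idx x))
    else knot u (idx x) + entry (u (idx x)) (x - knot u (idx x)))" for x
  define w where "w = map g [1..<knot u (2 * r + 3)]"
  have idx: "idx (knot u i + t) = i" if "i \<in> ?I" "t \<le> length (u i)" for i t
    unfolding idx_def
  proof (rule the_equality)
    show "i \<in> ?I \<and> knot u i \<le> knot u i + t \<and> knot u i + t < knot u (Suc i)"
      using that by (simp add: knot_Suc)
    then show "j = i" if "j \<in> ?I \<and> knot u j \<le> knot u i + t \<and> knot u i + t < knot u (Suc j)" for j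
      using interval_unique[OF knot_mono, of j "2 * r + 2" i u "knot u i + t"] that by blast
  qed
  have w: "entry w (knot u i + t) = g (knot u i + t)" if "i \<in> ?I" "t \<le> length (u i)" for i t
  proof -
    have "knot u i + t < knot u (Suc i)" using that by (simp add: knot_Suc)
    also have "\<dots> \<le> knot u (2 * r + 3)"
      using strict_mono_on_leD[OF knot_mono[of "2 * r + 3" u], of "Suc i" "2 * r + 3"] that by simp
    finally have "knot u i + t < knot u (2 * r + 3)" .
    moreover have "1 \<le> knot u i" using that by (simp add: knot_def)
    ultimately show ?thesis by (simp add: w_def entry_def del: upt.simps)
  qed
  have "knot u 1 \<le> knot u (2 * r + 3)" by (simp add: knot_def)
  then have "length w + 1 = knot u (2 * r + 3)"
    unfolding knot_1 by (simp add: w_def del: upt.simps)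
  moreover have "entry w (knot u i) = knot u (entry (psi r) i)" if "i \<in> ?I" for i
    using w[OF that, of 0] idx[OF that, of 0] by (simp add: g_def)
  moreover have "entry w (knot u i + t) = knot u i + entry (u i) t"
    if "i \<in> ?I" "t \<in> {1..length (u i)}" for i t
    using w[of i t] idx[of i t] that by (simp add: g_def)
  ultimately have "fits r u w" by (simp add: fits_def)
  then show ?thesis ..
qed

lemma fits_unique:
  assumes "fits r u w" "fits r u w'"
  shows "w = w'"
proof (rule nth_equalityI)
  show len: "length w = length w'" using assms unfolding fits_def by linarith
  fix x assume "x < length w"
  then have "Suc x \<in> {1..<knot u (2 * r + 3)}" using assms(1) unfolding fits_def by auto
  then obtain i t where it: "i \<in> {1..2 * r + 2}" "t \<le> length (u i)" "Suc x = knot u i + t"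
    by (rule knot_position)
  have "entry w (Suc x) = entry w' (Suc x)"
    using assms it unfolding fits_def by (cases "t = 0") auto
  then show "w ! x = w' ! x" by (simp add: entry_def)
qed

text \<open>Families are extensional, so distinct ones differ at some gap.\<close>

definition gap_fillings :: "nat \<Rightarrow> nat \<Rightarrow> (nat \<Rightarrow> nat list) set" where
  "gap_fillings r k = {u \<in> PiE {1..2 * r + 2} (filler r). (\<Sum>i\<in>{1..2 * r + 2}. length (u i)) = k}"

lemma fits_framed:
  assumes u: "u \<in> gap_fillings r k" and fits: "fits r u w" and n: "n = 2 * r + 2 + k"
  shows "nonempty_involution_word w n" "nonempty_involution_word.framed w n r (knot u)"
proof -
  let ?I = "{1..2 * r + 2}"
  have last: "knot u (2 * r + 3) = n + 1"
    using u knot_last[of u r] by (simp add: gap_fillings_def n)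
  then have len: "length w = n" using fits by (simp add: fits_def)
  have fil: "u i \<in> filler r i" if "i \<in> ?I" for i
    using u that by (auto simp: gap_fillings_def)
  have inv: "involution_word (u i) (length (u i))" if "i \<in> ?I" for i
    using filler_involution[OF fil[OF that]] by (rule involution_word.intro)
  have eK: "entry w (knot u i) = knot u (entry (psi r) i)" if "i \<in> ?I" for i
    using fits that by (simp add: fits_def)
  have eG: "entry w (knot u i + t) = knot u i + entry (u i) t" if "i \<in> ?I" "t \<in> {1..length (u i)}" for i t
    using fits that by (simp add: fits_def)
  have knot_in: "knot u i + t \<in> {1..n}" if "i \<in> ?I" "t \<le> length (u i)" for i t
  proof -
    have "knot u i + t < knot u (Suc i)" using that by (simp add: knot_Suc)
    also have "\<dots> \<le> knot u (2 * r + 3)"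
      using strict_mono_on_leD[OF knot_mono[of "2 * r + 3" u], of "Suc i" "2 * r + 3"] that by simp
    finally show ?thesis using that last by (simp add: knot_def)
  qed
  have "w \<in> involutions n"
  proof (rule involutionsI[OF len])
    fix x assume "x \<in> {1..n}"
    then have "x \<in> {1..<knot u (2 * r + 3)}" by (auto simp: last)
    then obtain i t where it: "i \<in> ?I" "t \<le> length (u i)" "x = knot u i + t"
      by (rule knot_position)
    show "entry w x \<in> {1..n} \<and> entry w (entry w x) = x"
    proof (cases "t = 0")
      case True
      have "entry (psi r) (entry (psi r) i) = i"
        using involution_word.f_f[OF involution_word.intro[OF psi_involution] it(1)] .
      then show ?thesis
        using True it eK psi_entry_in[OF it(1)] knot_in[of "entry (psi r) i" 0] by simp
    next
      case False
      then have t: "t \<in> {1..length (u i)}" using it by simp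
      have e: "entry (u i) t \<in> {1..length (u i)}" "entry (u i) (entry (u i) t) = t"
        using involution_word.f_in[OF inv[OF it(1)] t] involution_word.f_f[OF inv[OF it(1)] t] .
      then show ?thesis using it eG[OF it(1) t] eG[OF it(1) e(1)] knot_in[OF it(1)] by simp
    qed
  qed
  then show word: "nonempty_involution_word w n"
    by unfold_locales (simp_all add: n)
  interpret nonempty_involution_word w n by (rule word)
  let ?G = "\<lambda>i. {knot u i<..<knot u (Suc i)}"
  have gap: "\<exists>t. t \<in> {1..length (u i)} \<and> x = knot u i + t \<and> f x = knot u i + entry (u i) t \<and>
      entry (u i) t \<in> {1..length (u i)}"
    if "i \<in> ?I" "x \<in> ?G i" for i x
  proof -
    have t: "x - knot u i \<in> {1..length (u i)}" "x = knot u i + (x - knot u i)"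
      using that by (auto simp: knot_Suc)
    then show ?thesis
      using eG[OF that(1) t(1)] involution_word.f_in[OF inv[OF that(1)] t(1)] by (metis (no_types))
  qed
  have stable: "f x \<in> ?G i" if "i \<in> ?I" "x \<in> ?G i" for i x
    using gap[OF that] that(1) by (auto simp: knot_Suc)
  have dec: "f y < f x" if "i \<in> ?I" "even i" "i \<le> 2 * r" "x \<in> ?G i" "y \<in> ?G i" "x < y" for i x y
  proof -
    have "u i = rev [1..<length (u i) + 1]"
      using fil[OF that(1)] that(2,3) by (auto simp: filler_def simp del: upt.simps)
    then have "entry (u i) t = length (u i) + 1 - t" if "t \<in> {1..length (u i)}" for t
      using entry_rev_upt[OF that] by simp
    then show ?thesis using gap[OF that(1,4)] gap[OF that(1,5)] that(6) by auto
  qed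
  have no_pat: "\<not> pat c d a b"
    if G: "i \<in> ?I" "\<not> (even i \<and> i \<le> 2 * r)" "{a, b, c, d} \<subseteq> ?G i" for i a b c d
  proof
    assume p: "pat c d a b"
    interpret U: involution_word "u i" "length (u i)" by (rule inv[OF G(1)])
    obtain a' b' c' d' where t: "a' \<in> {1..length (u i)}" "a = knot u i + a'" "f a = knot u i + entry (u i) a'"
      "b' \<in> {1..length (u i)}" "b = knot u i + b'" "f b = knot u i + entry (u i) b'"
      "c' \<in> {1..length (u i)}" "c = knot u i + c'" "f c = knot u i + entry (u i) c'"
      "d' \<in> {1..length (u i)}" "d = knot u i + d'" "f d = knot u i + entry (u i) d'"
      using gap[OF G(1), of a] gap[OF G(1), of b] gap[OF G(1), of c] gap[OF G(1), of d] G(3)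
      by (simp del: atLeastAtMost_iff greaterThanLessThan_iff) blast
    then have "U.pat c' d' a' b'" using p by (simp add: pat_def U.pat_def)
    then have "occurrences (u i) \<noteq> {}" using U.in_occurrences_iff by blast
    moreover have "capacity (u i) = 0"
      using fil[OF G(1)] G(2) unfolding filler_def if_not_P[OF G(2)] by blast
    ultimately show False using U.finite_occurrences by (simp add: capacity_def)
  qed
  show "framed r (knot u)"
    by (rule framedI[OF knot_mono knot_1 last eK stable dec no_pat])
qed

text \<open>The knots enumerate the kernel, so \<open>w\<close> determines them, hence the lengths
  of the gaps and the words in them.\<close>

lemma fits_inj:
  assumes "u \<in> gap_fillings r k" "u' \<in> gap_fillings r k" "fits r u w" "fits r u' w"
  shows "u = u'"
proof -
  let ?I = "{1..2 * r + 2}"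
  let ?n = "2 * r + 2 + k"
  note fr = fits_framed[OF assms(1,3) refl] and fr' = fits_framed[OF assms(2,4) refl]
  interpret nonempty_involution_word w ?n by (rule fr)
  have "knot u ` ?I = knot u' ` ?I"
    using framed_kernel[OF fr(2)] framed_kernel[OF fr'(2)] by simp
  from strict_mono_on_image_unique(2)[OF knot_mono knot_mono this]
  have eq: "knot u i = knot u' i" if "i \<in> ?I" for i using that .
  \<comment> \<open>The sentinel is needed for the length of the last gap.\<close>
  have eq': "knot u i = knot u' i" if "i \<in> {1..2 * r + 3}" for i
    using eq[of i] that framedD(3)[OF fr(2)] framedD(3)[OF fr'(2)] by (cases "i = 2 * r + 3") auto
  have len: "length (u i) = length (u' i)" if "i \<in> ?I" for i
    using eq'[of i] eq'[of "Suc i"] knot_Suc[of i u] knot_Suc[of i u'] that by simp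
  have "u i = u' i" if i: "i \<in> ?I" for i
  proof (rule nth_equalityI[OF len[OF i]])
    fix t assume "t < length (u i)"
    then have "Suc t \<in> {1..length (u i)}" "Suc t \<in> {1..length (u' i)}" using len[OF i] by auto
    then have "knot u i + entry (u i) (Suc t) = knot u' i + entry (u' i) (Suc t)"
      using assms(3,4) i eq[OF i] unfolding fits_def by metis
    then show "u i ! t = u' i ! t" using eq[OF i] by (simp add: entry_def)
  qed
  then show ?thesis
    using assms(1,2) PiE_ext unfolding gap_fillings_def by blast
qed

lemma decreasing_involution:
  assumes "involution_word u k" "\<And>s t. s \<in> {1..k} \<Longrightarrow> t \<in> {1..k} \<Longrightarrow> s < t \<Longrightarrow> entry u t < entry u s"
  shows "u = rev [1..<k + 1]"
proof -
  interpret involution_word u k by (rule assms(1))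
  have "rev u = [1..<k + 1]"
  proof (rule sorted_distinct_set_unique)
    have "sorted_wrt (>) u"
      unfolding sorted_wrt_iff_nth_less
    proof (intro allI impI)
      fix i j assume "i < j" "j < length u"
      then show "u ! j < u ! i"
        using assms(2)[of "Suc i" "Suc j"] by (simp add: length_w entry_def)
    qed
    then show "sorted (rev u)"
      unfolding sorted_wrt_rev by (rule sorted_wrt_mono_rel[rotated]) simp
  qed (use set_w distinct_w in \<open>simp_all add: atLeastLessThanSuc_atLeastAtMost del: upt.simps\<close>)
  then show ?thesis by (metis rev_rev_ident)
qed

context nonempty_involution_word
begin

lemma framed_fits:
  assumes fr: "framed r K"
  shows "\<exists>k. \<exists>u\<in>gap_fillings r k. n = 2 * r + 2 + k \<and> fits r u w"
proof -
  let ?I = "{1..2 * r + 2}"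
  let ?G = "\<lambda>i. {K i<..<K (Suc i)}"
  \<comment> \<open>The word in gap \<open>i\<close>, with positions and entries both lowered by
    \<open>K i\<close>.\<close>
  define u where "u = (\<lambda>i\<in>?I. map (\<lambda>t. f (K i + t) - K i) [1..<K (Suc i) - K i])"
  have mono: "K i < K (Suc i)" if "i \<in> ?I" for i
    using strict_mono_onD[OF framedD(1)[OF fr], of i "Suc i"] that by simp
  have len: "length (u i) = K (Suc i) - K i - 1" if "i \<in> ?I" for i
    using that by (simp add: u_def del: upt.simps)
  have G: "K i + t \<in> ?G i" if "i \<in> ?I" "t \<in> {1..length (u i)}" for i t
    using that len[OF that(1)] mono[OF that(1)] by auto
  have eu: "K i + entry (u i) t = f (K i + t)" if "i \<in> ?I" "t \<in> {1..length (u i)}" for i t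
  proof -
    have "t - 1 < K (Suc i) - K i - 1" using that len[OF that(1)] by auto
    then have "entry (u i) t = f (K i + t) - K i"
      using that by (simp add: u_def entry_def del: upt.simps)
    then show ?thesis using framedD(5)[OF fr that(1) G[OF that]] by simp
  qed
  have eu_in: "entry (u i) t \<in> {1..length (u i)}" if "i \<in> ?I" "t \<in> {1..length (u i)}" for i t
    using framedD(5)[OF fr that(1) G[OF that]] len[OF that(1)] mono[OF that(1)]
    unfolding eu[OF that, symmetric] by auto
  have G_in: "K i + t \<in> {1..n}" if "i \<in> ?I" "t \<in> {1..length (u i)}" for i t
  proof -
    have "K (Suc i) \<le> n + 1"
      using strict_mono_on_leD[OF framedD(1)[OF fr], of "Suc i" "2 * r + 3"] framedD(3)[OF fr] that(1) by simp
    then show ?thesis using G[OF that] that(2) by auto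
  qed
  have inv: "u i \<in> involutions (length (u i))" if i: "i \<in> ?I" for i
  proof (rule involutionsI[OF refl])
    fix t assume t: "t \<in> {1..length (u i)}"
    have "K i + entry (u i) (entry (u i) t) = f (f (K i + t))"
      using eu[OF i eu_in[OF i t]] eu[OF i t] by simp
    then show "entry (u i) t \<in> {1..length (u i)} \<and> entry (u i) (entry (u i) t) = t"
      using eu_in[OF i t] f_f[OF G_in[OF i t]] by simp
  qed
  have "u i \<in> filler r i" if i: "i \<in> ?I" for i
  proof (cases "even i \<and> i \<le> 2 * r")
    case True
    have "u i = rev [1..<length (u i) + 1]"
    proof (rule decreasing_involution[OF involution_word.intro[OF inv[OF i]]])
      fix s t assume st: "s \<in> {1..length (u i)}" "t \<in> {1..length (u i)}" "s < t"
      have "f (K i + t) < f (K i + s)"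
        using framedD(6)[OF fr i] True G[OF i st(1)] G[OF i st(2)] st(3) by simp
      then show "entry (u i) t < entry (u i) s" using eu[OF i st(1)] eu[OF i st(2)] by linarith
    qed
    then show ?thesis using True unfolding filler_def by auto
  next
    case False
    interpret U: involution_word "u i" "length (u i)" by (rule involution_word.intro[OF inv[OF i]])
    have "\<not> U.pat c d a b" for c d a b
    proof
      assume p: "U.pat c d a b"
      then have dom: "a \<in> {1..length (u i)}" "b \<in> {1..length (u i)}" "c \<in> {1..length (u i)}" "d \<in> {1..length (u i)}"
        by (auto simp: U.pat_def)
      have "pat (K i + c) (K i + d) (K i + a) (K i + b)"
        unfolding pat_def using p G_in[OF i] dom by (simp add: U.pat_def eu[OF i, symmetric])
      moreover have "{K i + a, K i + b, K i + c, K i + d} \<subseteq> ?G i" using G[OF i] dom by blast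
      ultimately show False using framedD(6)[OF fr i] unfolding if_not_P[OF False] by blast
    qed
    then have "occurrences (u i) = {}" by (auto simp: U.occurrences_eq)
    then show ?thesis
      using inv[OF i] unfolding filler_def if_not_P[OF False] by (simp add: capacity_def)
  qed
  moreover have "u \<in> extensional ?I" by (simp add: u_def)
  ultimately have uPi: "u \<in> PiE ?I (filler r)" by (simp add: PiE_iff)
  have knot: "knot u i = K i" if "i \<in> {1..2 * r + 3}" for i
    using that
  proof (induction i)
    case (Suc i)
    show ?case
    proof (cases "i = 0")
      case True
      then show ?thesis using framedD(2)[OF fr] by (simp add: knot_1[simplified])
    next
      case False
      then have i: "i \<in> ?I" using Suc.prems by simp
      then show ?thesis using Suc.IH knot_Suc[of i u] len[OF i] mono[OF i] by simp
    qed
  qed simp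
  have n: "knot u (2 * r + 3) = n + 1" using knot[of "2 * r + 3"] framedD(3)[OF fr] by simp
  have "fits r u w"
    unfolding fits_def
  proof (intro conjI ballI)
    show "length w + 1 = knot u (2 * r + 3)" using n length_w by simp
    fix i assume i: "i \<in> ?I"
    have ki: "knot u i = K i" using knot i by simp
    show "entry w (knot u i) = knot u (entry (psi r) i)"
      using framedD(4)[OF fr i] ki knot[of "entry (psi r) i"] psi_entry_in[OF i] by simp
    show "entry w (knot u i + t) = knot u i + entry (u i) t" if "t \<in> {1..length (u i)}" for t
      using eu[OF i that] ki by simp
  qed
  moreover have "n = 2 * r + 2 + (\<Sum>i\<in>?I. length (u i))"
    using n knot_last[of u r] by simp
  ultimately show ?thesis using uPi by (auto simp: gap_fillings_def)
qed

end

lemma card_psi_words: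
  "card {w \<in> involutions n \<inter> involutions_of_shape (psi r). capacity w = r} =
    (if n < 2 * r + 2 then 0 else card (gap_fillings r (n - (2 * r + 2))))"
proof -
  let ?T = "{w \<in> involutions n \<inter> involutions_of_shape (psi r). capacity w = r}"
  have T: "\<exists>u\<in>gap_fillings r k. n = 2 * r + 2 + k \<and> fits r u w" if "w \<in> ?T" "k = n - (2 * r + 2)" for w k
  proof -
    have shape: "w \<in> involutions n" "kernel_shape w (psi r)" "capacity w = r"
      using that by (auto simp: involutions_of_shape_def)
    \<comment> \<open>\<open>involutions_of_shape\<close> provides some positive size; comparing
      lengths identifies it with \<open>n\<close>.\<close>
    have "1 \<le> n"
      using that length_involution[OF shape(1)] by (auto simp: involutions_of_shape_def dest: length_involution)
    then interpret nonempty_involution_word w n by unfold_locales (use shape in auto)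
    show ?thesis using framed_of_kernel_shape[OF shape(2,3)] framed_fits that(2) by fastforce
  qed
  show ?thesis
  proof (cases "n < 2 * r + 2")
    case True
    then have "?T = {}" using T by force
    then show ?thesis by (simp only: True card.empty if_True)
  next
    case False
    define k where "k = n - (2 * r + 2)"
    have n: "n = 2 * r + 2 + k" using False by (simp add: k_def)
    \<comment> \<open>By \<open>fits_exists\<close> and \<open>fits_unique\<close> the choice is
      determined: this is the assembling map.\<close>
    define \<Phi> where "\<Phi> u = (SOME w. fits r u w)" for u
    have \<Phi>: "fits r u (\<Phi> u)" for u unfolding \<Phi>_def using fits_exists by (rule someI_ex)
    have "inj_on \<Phi> (gap_fillings r k)"
      using fits_inj \<Phi> by (metis inj_onI)
    moreover have "\<Phi> ` gap_fillings r k = ?T"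
    proof (intro equalityI subsetI)
      fix w assume "w \<in> \<Phi> ` gap_fillings r k"
      then obtain u where u: "u \<in> gap_fillings r k" "fits r u w" using \<Phi> by blast
      interpret nonempty_involution_word w n by (rule fits_framed(1)[OF u n])
      show "w \<in> ?T"
        using framed_kernel_shape[OF fits_framed(2)[OF u n]] w n_pos by (auto simp: involutions_of_shape_def)
    next
      fix w assume "w \<in> ?T"
      then obtain u where "u \<in> gap_fillings r k" "fits r u w" using T k_def by blast
      then show "w \<in> \<Phi> ` gap_fillings r k" using fits_unique \<Phi> by blast
    qed
    ultimately have "card ?T = card (gap_fillings r k)" by (metis card_image)
    then show ?thesis using False by (simp add: k_def)
  qed
qed

lemma contribution_psi:
  "contribution (psi r) r = fps_X ^ (2 * r + 2) / (1 - fps_X) ^ r * I_gf 0 ^ (r + 2)"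
proof -
  define P where "P = (\<Prod>i\<in>{1..2 * r + 2}. length_gf (filler r i))"
  have card_fillings: "of_nat (card (gap_fillings r k)) = fps_nth P k" for k
    using PiE_length_gf[of "{1..2 * r + 2}" "filler r" k] finite_filler
    unfolding gap_fillings_def P_def by blast
  have "contribution (psi r) r = fps_X ^ (2 * r + 2) * P"
  proof (rule fps_ext)
    fix n
    show "fps_nth (contribution (psi r) r) n = fps_nth (fps_X ^ (2 * r + 2) * P) n"
      unfolding contribution_def card_psi_words fps_X_power_mult_nth fps_nth_Abs_fps
      by (cases "n < 2 * r + 2") (simp_all only: if_True if_False of_nat_0 card_fillings)
  qed
  also have "P = inverse ((1 - fps_X) ^ r) * I_gf 0 ^ (r + 2)"
    unfolding P_def prod_length_gf_filler by (simp add: fps_inverse_power)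
  also have "fps_X ^ (2 * r + 2) * (inverse ((1 - fps_X) ^ r) * I_gf 0 ^ (r + 2)) =
    fps_X ^ (2 * r + 2) / (1 - fps_X) ^ r * I_gf 0 ^ (r + 2)"
    by (simp add: fps_divide_unit mult.assoc)
  finally show ?thesis .
qed

theorem proposition3p2:
  fixes r :: nat
  shows "{\<rho>. kernel_involution \<rho> \<and> capacity \<rho> = r \<and> length \<rho> = 2 * r + 2} = {psi r} \<and>
         contribution (psi r) r = fps_X ^ (2 * r + 2) / (1 - fps_X) ^ r * I_gf 0 ^ (r + 2)"
proof
  have "\<rho> = psi r" if \<rho>: "kernel_involution \<rho>" "capacity \<rho> = r" "length \<rho> = 2 * r + 2" for \<rho>
  proof -
    obtain n w where shape: "1 \<le> n" "w \<in> involutions n" "kernel_shape w \<rho>"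
      using \<rho>(1) by (auto simp: kernel_involution_def)
    then interpret nonempty_involution_word w n by unfold_locales
    show ?thesis using extremal_kernel_shape shape(3) \<rho>(2,3) by blast
  qed
  moreover have "kernel_involution (psi r)"
    unfolding kernel_involution_def
    using psi_involution kernel_shape_psi by (intro exI[of _ "2 * r + 2"]) auto
  ultimately show "{\<rho>. kernel_involution \<rho> \<and> capacity \<rho> = r \<and> length \<rho> = 2 * r + 2} = {psi r}"
    using capacity_psi[of r] length_psi[of r] by blast
qed (rule contribution_psi)

end
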